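(* The simultaneous conjugacy problem in Garside groups is solvable: for every Garside group $G$ and every natural number $r$, there is an algorithm that, given two $r$-tuples $a=(a_1,\dotsc,a_r)$ and $c=(c_1,\dotsc,c_r)$ of elements of $G$, decides whether there is an element $x\in G$ such that $x^{-1}a_ix=c_i$ for all $i=1,\dotsc,r$.
   Context: A monoid $M$ is Noetherian if for each $a\in M$ there is $n\in\mathbb N$ such that $a$ is not a product of more than $n$ nonidentity elements. In a monoid, $a$ is a left divisor of $b$ ($a\preceq b$) if $b\in aM$, and a right divisor of $b$ ($b\succeq a$) if $b\in Ma$. $M$ is Gaussian if it is Noetherian, cancellative, and every pair of elements has a right lcm (least upper bound for $\preceq$) and a left lcm (the analogous notion for right divisibility). A Garside group is a group $G$ equipped with a finite subset $S$ (the simple elements) and an element $\Delta$ (the Garside element) such that the monoid $G^+$ generated by $S$ is Gaussian with group of fractions $G$, $\Delta\in G^+$ is balanced (its left and right divisors coincide), and $S$ is the set of divisors of $\Delta$ in $G^+$. Elements of $G$ are given to the algorithm as words in the finite generating set $S$ and inverses of its elements; the (finite) Garside structure, including the partial multiplication on $S$, is fixed and known. *)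

theory Defs
  imports "HOL-Algebra.Divisibility" "HOL-Library.Nat_Bijection"
begin

section \<open>Garside groups\<close>

text \<open>
  Left divisibility \<open>a \<preceq> b\<close> in \<open>M\<close> (that is, \<open>b \<in> aM\<close>) is
  the library relation \<open>a divides\<^bsub>M\<^esub> b\<close>.
\<close>

definition right_divides :: "('a, 'b) monoid_scheme \<Rightarrow> 'a \<Rightarrow> 'a \<Rightarrow> bool" where
  "right_divides M a b \<longleftrightarrow> (\<exists>c\<in>carrier M. b = c \<otimes>\<^bsub>M\<^esub> a)"

definition list_prod :: "('a, 'b) monoid_scheme \<Rightarrow> 'a list \<Rightarrow> 'a" where
  "list_prod M xs = foldr (\<otimes>\<^bsub>M\<^esub>) xs \<one>\<^bsub>M\<^esub>"

definition noetherian_monoid :: "('a, 'b) monoid_scheme \<Rightarrow> bool" where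
  "noetherian_monoid M \<longleftrightarrow>
    (\<forall>a\<in>carrier M. \<exists>n. \<forall>xs. set xs \<subseteq> carrier M - {\<one>\<^bsub>M\<^esub>} \<and> list_prod M xs = a \<longrightarrow> length xs \<le> n)"

definition is_lub :: "'a set \<Rightarrow> ('a \<Rightarrow> 'a \<Rightarrow> bool) \<Rightarrow> 'a \<Rightarrow> 'a \<Rightarrow> 'a \<Rightarrow> bool" where
  "is_lub A R a b m \<longleftrightarrow>
    m \<in> A \<and> R a m \<and> R b m \<and> (\<forall>m'\<in>A. R a m' \<and> R b m' \<longrightarrow> R m m')"

text \<open>The right lcm is the lub for \<^emph>\<open>left\<close> divisibility, and vice versa.\<close>

definition is_right_lcm :: "('a, 'b) monoid_scheme \<Rightarrow> 'a \<Rightarrow> 'a \<Rightarrow> 'a \<Rightarrow> bool" where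
  "is_right_lcm M a b m \<longleftrightarrow> is_lub (carrier M) (\<lambda>x y. x divides\<^bsub>M\<^esub> y) a b m"

definition is_left_lcm :: "('a, 'b) monoid_scheme \<Rightarrow> 'a \<Rightarrow> 'a \<Rightarrow> 'a \<Rightarrow> bool" where
  "is_left_lcm M a b m \<longleftrightarrow> is_lub (carrier M) (right_divides M) a b m"

definition gaussian_monoid :: "('a, 'b) monoid_scheme \<Rightarrow> bool" where
  "gaussian_monoid M \<longleftrightarrow>
    monoid_cancel M \<and> noetherian_monoid M \<and>
    (\<forall>a\<in>carrier M. \<forall>b\<in>carrier M. (\<exists>m. is_right_lcm M a b m) \<and> (\<exists>m. is_left_lcm M a b m))"

inductive_set monoid_generate :: "('a, 'b) monoid_scheme \<Rightarrow> 'a set \<Rightarrow> 'a set"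
  for G and S where
  one: "\<one>\<^bsub>G\<^esub> \<in> monoid_generate G S"
| incl: "s \<in> S \<Longrightarrow> s \<in> monoid_generate G S"
| mult: "x \<in> monoid_generate G S \<Longrightarrow> y \<in> monoid_generate G S \<Longrightarrow> x \<otimes>\<^bsub>G\<^esub> y \<in> monoid_generate G S"

text \<open>
  A submonoid \<open>H\<close> of a group \<open>G\<close> has \<open>G\<close> as its group of (right) fractions
  iff every element of \<open>G\<close> is a fraction \<open>a b\<inverse>\<close> with \<open>a, b \<in> H\<close>.  When right
  lcms exist in \<open>H\<close>, this pins down \<open>G\<close> up to isomorphism over \<open>H\<close>.
\<close>

definition group_of_fractions :: "('a, 'b) monoid_scheme \<Rightarrow> 'a set \<Rightarrow> bool" where
  "group_of_fractions G H \<longleftrightarrow> group G \<and> submonoid H G \<and>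
    (\<forall>g\<in>carrier G. \<exists>a\<in>H. \<exists>b\<in>H. g = a \<otimes>\<^bsub>G\<^esub> inv\<^bsub>G\<^esub> b)"

definition positive_monoid :: "('a, 'b) monoid_scheme \<Rightarrow> 'a set \<Rightarrow> ('a, 'b) monoid_scheme" where
  "positive_monoid G S = G\<lparr>carrier := monoid_generate G S\<rparr>"

definition left_divisors :: "('a, 'b) monoid_scheme \<Rightarrow> 'a \<Rightarrow> 'a set" where
  "left_divisors M b = {a \<in> carrier M. a divides\<^bsub>M\<^esub> b}"

definition right_divisors :: "('a, 'b) monoid_scheme \<Rightarrow> 'a \<Rightarrow> 'a set" where
  "right_divisors M b = {a \<in> carrier M. right_divides M a b}"

definition balanced :: "('a, 'b) monoid_scheme \<Rightarrow> 'a \<Rightarrow> bool" where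
  "balanced M b \<longleftrightarrow> left_divisors M b = right_divisors M b"

text \<open>
  By \<open>balanced\<close>, the last assumption does not depend on the side of divisibility.
\<close>

locale garside_group = group G
  for G (structure) and S :: "'a set" and \<Delta> :: 'a +
  assumes simples_finite: "finite S"
    and simples_closed: "S \<subseteq> carrier G"
    and gaussian: "gaussian_monoid (positive_monoid G S)"
    and fractions: "group_of_fractions G (monoid_generate G S)"
    and Delta_positive: "\<Delta> \<in> carrier (positive_monoid G S)"
    and Delta_balanced: "balanced (positive_monoid G S) \<Delta>"
    and simples_divisors: "S = left_divisors (positive_monoid G S) \<Delta>"

definition simultaneously_conjugate :: "('a, 'b) monoid_scheme \<Rightarrow> 'a list \<Rightarrow> 'a list \<Rightarrow> bool" where
  "simultaneously_conjugate G as cs \<longleftrightarrow> length as = length cs \<and>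
    (\<exists>x\<in>carrier G. \<forall>i<length as. inv\<^bsub>G\<^esub> x \<otimes>\<^bsub>G\<^esub> (as ! i) \<otimes>\<^bsub>G\<^esub> x = cs ! i)"

section \<open>Words\<close>

text \<open>The letter \<open>(s, True)\<close> stands for \<open>s\<close>, and \<open>(s, False)\<close> for its inverse.\<close>

type_synonym 'a word = "('a \<times> bool) list"

definition words :: "'a set \<Rightarrow> 'a word set" where
  "words S = lists (S \<times> UNIV)"

definition letter_value :: "('a, 'b) monoid_scheme \<Rightarrow> 'a \<times> bool \<Rightarrow> 'a" where
  "letter_value G l = (if snd l then fst l else inv\<^bsub>G\<^esub> (fst l))"

definition word_value :: "('a, 'b) monoid_scheme \<Rightarrow> 'a word \<Rightarrow> 'a" where
  "word_value G w = list_prod G (map (letter_value G) w)"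

definition word_tuples :: "'a set \<Rightarrow> nat \<Rightarrow> 'a word list set" where
  "word_tuples S r = {ws. set ws \<subseteq> words S \<and> length ws = r}"

text \<open>
  Codes of inputs as natural numbers, relative to a numbering \<open>num\<close> of the generators.
\<close>

definition letter_code :: "('a \<Rightarrow> nat) \<Rightarrow> 'a \<times> bool \<Rightarrow> nat" where
  "letter_code num l = 2 * num (fst l) + of_bool (snd l)"

definition word_code :: "('a \<Rightarrow> nat) \<Rightarrow> 'a word \<Rightarrow> nat" where
  "word_code num w = list_encode (map (letter_code num) w)"

definition tuple_code :: "('a \<Rightarrow> nat) \<Rightarrow> 'a word list \<Rightarrow> nat" where
  "tuple_code num ws = list_encode (map (word_code num) ws)"

definition instance_code :: "('a \<Rightarrow> nat) \<Rightarrow> 'a word list \<times> 'a word list \<Rightarrow> nat" where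
  "instance_code num p = prod_encode (tuple_code num (fst p), tuple_code num (snd p))"

section \<open>Algorithms\<close>

text \<open>
  Algorithms are programs for partial recursive functions (Kleene):
  \<open>computes p xs y\<close> means that \<open>p\<close> halts on the arguments \<open>xs\<close> with result \<open>y\<close>.
  Arities are not tracked; a program applied to too few arguments has no result.
\<close>

datatype program =
    Zero
  | Succ
  | Proj nat
  | Comp program "program list"
  | PrimRec program program
  | Mu program

inductive computes :: "program \<Rightarrow> nat list \<Rightarrow> nat \<Rightarrow> bool" where
  Zero: "computes Zero xs 0"
| Succ: "computes Succ (x # xs) (Suc x)"
| Proj: "i < length xs \<Longrightarrow> computes (Proj i) xs (xs ! i)"
| Comp: "list_all2 (\<lambda>g y. computes g xs y) gs ys \<Longrightarrow> computes f ys z \<Longrightarrow> computes (Comp f gs) xs z"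
| PrimRec_0: "computes f xs y \<Longrightarrow> computes (PrimRec f g) (0 # xs) y"
| PrimRec_Suc: "computes (PrimRec f g) (k # xs) v \<Longrightarrow> computes g (k # v # xs) y \<Longrightarrow>
    computes (PrimRec f g) (Suc k # xs) y"
| Mu: "computes f (y # xs) 0 \<Longrightarrow> (\<And>i. i < y \<Longrightarrow> \<exists>v>0. computes f (i # xs) v) \<Longrightarrow>
    computes (Mu f) xs y"

inductive_cases computes_ZeroE: "computes Zero xs y"
inductive_cases computes_SuccE: "computes Succ xs y"
inductive_cases computes_ProjE: "computes (Proj i) xs y"
inductive_cases computes_CompE: "computes (Comp f gs) xs y"
inductive_cases computes_PrimRec_0E: "computes (PrimRec f g) (0 # xs) y"
inductive_cases computes_PrimRec_SucE: "computes (PrimRec f g) (Suc k # xs) y"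
inductive_cases computes_MuE: "computes (Mu f) xs y"

lemma computes_deterministic: "computes p xs y \<Longrightarrow> computes p xs z \<Longrightarrow> y = z"
proof (induction arbitrary: z rule: computes.induct)
  case (Zero xs)
  then show ?case by (rule computes_ZeroE) simp
next
  case (Succ x xs)
  then show ?case by (rule computes_SuccE) simp
next
  case (Proj i xs)
  from Proj.prems show ?case by (rule computes_ProjE) simp
next
  case (Comp xs gs ys f y)
  from Comp.prems obtain us
    where us: "list_all2 (\<lambda>g y. computes g xs y) gs us" "computes f us z"
    by (rule computes_CompE)
  have "ys = us"
    using Comp.IH(1) us(1) by (intro nth_equalityI) (simp_all add: list_all2_conv_all_nth)
  with Comp.IH(2) us(2) show ?case by simp
next
  case (PrimRec_0 f xs y g)
  from PrimRec_0.prems have "computes f xs z" by (rule computes_PrimRec_0E)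
  then show ?case by (rule PrimRec_0.IH)
next
  case (PrimRec_Suc f g k xs v y)
  from PrimRec_Suc.prems obtain u
    where u: "computes (PrimRec f g) (k # xs) u" "computes g (k # u # xs) z"
    by (rule computes_PrimRec_SucE)
  from PrimRec_Suc.IH(1)[OF u(1)] u(2) have "computes g (k # v # xs) z" by simp
  then show ?case by (rule PrimRec_Suc.IH(2))
next
  case (Mu f y xs)
  from Mu.prems have z: "computes f (z # xs) 0" "\<And>i. i < z \<Longrightarrow> \<exists>v>0. computes f (i # xs) v"
    by (rule computes_MuE, blast)+
  have "\<not> y < z" using Mu.IH(1) z(2) by (metis less_irrefl)
  moreover have "\<not> z < y" using Mu.IH(2) z(1) by (metis less_irrefl)
  ultimately show ?case by simp
qed

text \<open>
  \<open>P\<close> is decided by an algorithm on the inputs in \<open>I\<close>; on numbers that do not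
  code an input, the behaviour of the algorithm is irrelevant.
\<close>

definition decidable_on :: "('i \<Rightarrow> nat) \<Rightarrow> 'i set \<Rightarrow> ('i \<Rightarrow> bool) \<Rightarrow> bool" where
  "decidable_on code I P \<longleftrightarrow> (\<exists>p. \<forall>x\<in>I. computes p [code x] (if P x then 1 else 0))"

end

theory Submission
  imports Defs
begin

text \<open>
  Some power \<open>Z\<close> of \<open>\<Delta>\<close> is central, so every element of \<open>G\<close> is a positive one times a power of \<open>Z\<close>,
  and only positive conjugators \<open>x\<close> matter.  Let \<open>I\<close> be the finite set of elements \<open>g\<close> such that both
  \<open>Z\<^sup>k g\<close> and \<open>Z\<^sup>k g\<inverse>\<close> are positive, with \<open>k\<close> so large that all \<open>a\<^sub>i\<close> and \<open>c\<^sub>i\<close> lie in \<open>I\<close>.  If \<open>a\<close>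
  and \<open>x\<inverse> a x\<close> are in \<open>I\<close>, then so is \<open>d\<inverse> a d\<close> for the left gcd \<open>d\<close> of \<open>x\<close> and \<open>\<Delta>\<close>.  Hence conjugate
  tuples over \<open>I\<close> are joined by a chain of conjugations by simple elements within the tuples over
  \<open>I\<close>.  Their number is at most \<open>\<bar>S\<bar>\<^bsup>2ekr\<^esup>\<close> if \<open>Z = \<Delta>\<^sup>e\<close>, which yields a computable bound on the length
  of a conjugator as a word in \<open>S\<close>.  Finitely many candidates remain, and each is tested by the
  word problem for positive words, which is solved by dividing one word by the letters of the other
  with the help of the finite table of lcms in \<open>S\<close>.
\<close>

section \<open>Computable functions on coded types\<close>

lemma computes_Proj: "i < length xs \<Longrightarrow> xs ! i = y \<Longrightarrow> computes (Proj i) xs y"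
  using computes.Proj by blast

lemma computes_Comp1: "computes g xs y \<Longrightarrow> computes f [y] z \<Longrightarrow> computes (Comp f [g]) xs z"
  by (rule computes.Comp[where ys = "[y]"]) simp_all

lemma computes_Comp2:
  "computes g xs y \<Longrightarrow> computes h xs y' \<Longrightarrow> computes f [y, y'] z \<Longrightarrow> computes (Comp f [g, h]) xs z"
  by (rule computes.Comp[where ys = "[y, y']"]) simp_all

lemma computes_PrimRec:
  assumes "computes f xs a" and "\<And>k v. computes g (k # v # xs) (h k v)"
  shows "computes (PrimRec f g) (n # xs) (rec_nat a h n)"
  by (induction n) (auto intro: computes.intros assms)

definition add_prog :: program where
  "add_prog = PrimRec (Proj 0) (Comp Succ [Proj 1])"

lemma computes_add: "computes add_prog [x, y] (x + y)"
proof -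
  have "computes add_prog [x, y] (rec_nat y (\<lambda>_. Suc) x)"
    unfolding add_prog_def
    by (intro computes_PrimRec computes_Comp1[OF _ computes.Succ] computes_Proj) simp_all
  moreover have "rec_nat y (\<lambda>_. Suc) x = x + y" by (induction x) simp_all
  ultimately show ?thesis by simp
qed

definition triangle_prog :: program where
  "triangle_prog = PrimRec Zero (Comp Succ [Comp add_prog [Proj 0, Proj 1]])"

lemma computes_triangle: "computes triangle_prog [x] (triangle x)"
proof -
  have "computes triangle_prog [x] (rec_nat 0 (\<lambda>k v. Suc (k + v)) x)"
    unfolding triangle_prog_def
    by (intro computes_PrimRec computes_Comp1[OF _ computes.Succ] computes.Zero
        computes_Comp2[OF _ _ computes_add] computes_Proj) simp_all
  moreover have "rec_nat 0 (\<lambda>k v. Suc (k + v)) x = triangle x" by (induction x) simp_all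
  ultimately show ?thesis by simp
qed

definition pair_prog :: program where
  "pair_prog = Comp add_prog [Comp triangle_prog [add_prog], Proj 0]"

lemma computes_pair: "computes pair_prog [x, y] (prod_encode (x, y))"
  unfolding pair_prog_def prod_encode_def
  by (auto intro!: computes_Comp2[OF _ _ computes_add] computes_Comp1[OF _ computes_triangle]
      computes_add computes_Proj)

definition pred_prog :: program where
  "pred_prog = PrimRec Zero (Proj 0)"

lemma computes_pred: "computes pred_prog [x] (x - 1)"
proof -
  have "computes pred_prog [x] (rec_nat 0 (\<lambda>k v. k) x)"
    unfolding pred_prog_def by (intro computes_PrimRec computes.Zero computes_Proj) simp_all
  moreover have "rec_nat 0 (\<lambda>k v. k) x = x - 1" by (induction x) simp_all
  ultimately show ?thesis by simp
qed

definition sign_prog :: program where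
  "sign_prog = PrimRec Zero (Comp Succ [Zero])"

lemma computes_sign: "computes sign_prog [x] (of_bool (x > 0))"
proof -
  have "computes sign_prog [x] (rec_nat 0 (\<lambda>k v. Suc 0) x)"
    unfolding sign_prog_def
    by (intro computes_PrimRec computes_Comp1[OF _ computes.Succ] computes.Zero)
  moreover have "rec_nat 0 (\<lambda>k v. Suc 0) x = of_bool (x > 0)" by (induction x) simp_all
  ultimately show ?thesis by simp
qed

text \<open>\<open>PrimRec\<close> recurses on its first argument, so the subtrahend has to come
  first.\<close>

definition flipped_minus_prog :: program where
  "flipped_minus_prog = PrimRec (Proj 0) (Comp pred_prog [Proj 1])"

lemma computes_flipped_minus: "computes flipped_minus_prog [y, x] (x - y)"
proof -
  have "computes flipped_minus_prog [y, x] (rec_nat x (\<lambda>k v. v - 1) y)"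
    unfolding flipped_minus_prog_def
    by (intro computes_PrimRec computes_Comp1[OF _ computes_pred] computes_Proj) simp_all
  moreover have "rec_nat x (\<lambda>k v. v - 1) y = x - y" by (induction y) simp_all
  ultimately show ?thesis by simp
qed

text \<open>
  Since \<open>prod_encode (m, n) = triangle (m + n) + m\<close> lies below \<open>triangle (Suc (m + n))\<close>,
  the sum \<open>m + n\<close> is recovered by minimization.
\<close>

definition coord_sum_prog :: program where
  "coord_sum_prog = Mu (Comp flipped_minus_prog [Comp triangle_prog [Comp Succ [Proj 0]],
    Comp Succ [Proj 1]])"

lemma triangle_mono: "m \<le> n \<Longrightarrow> triangle m \<le> triangle n"
  by (induction rule: dec_induct) simp_all

lemma computes_coord_sum: "computes coord_sum_prog [prod_encode (m, n)] (m + n)"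
proof -
  let ?z = "prod_encode (m, n)"
  let ?f = "Comp flipped_minus_prog [Comp triangle_prog [Comp Succ [Proj 0]], Comp Succ [Proj 1]]"
  \<comment> \<open>Truncated subtraction vanishes exactly when
    \<open>?z < triangle (Suc i)\<close>, which gives the comparison the form that \<open>Mu\<close>
    searches for.\<close>
  have *: "computes ?f [i, ?z] (Suc ?z - triangle (Suc i))" for i
    by (intro computes_Comp2[OF _ _ computes_flipped_minus] computes_Comp1[OF _ computes_triangle]
        computes_Comp1[OF _ computes.Succ] computes_Proj) simp_all
  show ?thesis
    unfolding coord_sum_prog_def
  proof (rule computes.Mu)
    have "Suc ?z - triangle (Suc (m + n)) = 0"
      by (simp add: prod_encode_def)
    with *[of "m + n"] show "computes ?f [m + n, ?z] 0" by simp
  next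
    fix i assume "i < m + n"
    then have "triangle (Suc i) \<le> triangle (m + n)" by (intro triangle_mono) simp
    then have "Suc ?z - triangle (Suc i) > 0" by (simp add: prod_encode_def del: triangle_Suc)
    with * show "\<exists>v>0. computes ?f [i, ?z] v" by blast
  qed
qed

definition fst_prog :: program where
  "fst_prog = Comp flipped_minus_prog [Comp triangle_prog [coord_sum_prog], Proj 0]"

definition snd_prog :: program where
  "snd_prog = Comp flipped_minus_prog [fst_prog, coord_sum_prog]"

lemma computes_fst: "computes fst_prog [prod_encode (m, n)] m"
proof -
  have "computes fst_prog [prod_encode (m, n)] (prod_encode (m, n) - triangle (m + n))"
    unfolding fst_prog_def
    by (intro computes_Comp2[OF _ _ computes_flipped_minus] computes_Comp1[OF _ computes_triangle]
        computes_coord_sum computes_Proj) simp_all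
  then show ?thesis by (simp add: prod_encode_def)
qed

lemma computes_snd: "computes snd_prog [prod_encode (m, n)] n"
proof -
  have "computes snd_prog [prod_encode (m, n)] (m + n - m)"
    unfolding snd_prog_def
    by (intro computes_Comp2[OF _ _ computes_flipped_minus] computes_coord_sum computes_fst)
  then show ?thesis by simp
qed

section \<open>Coded types and the computable functions between them\<close>

class coded =
  fixes encode :: "'a \<Rightarrow> nat"
  assumes inj_encode: "inj encode"

instantiation nat :: coded
begin
definition encode_nat :: "nat \<Rightarrow> nat" where [simp]: "encode_nat n = n"
instance by standard (simp add: inj_def)
end

instantiation bool :: coded
begin
definition encode_bool :: "bool \<Rightarrow> nat" where [simp]: "encode_bool b = of_bool b"
instance by standard (simp add: inj_def of_bool_def)
end

instantiation prod :: (coded, coded) coded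
begin
definition encode_prod :: "'a \<times> 'b \<Rightarrow> nat"
  where [simp]: "encode_prod p = prod_encode (encode (fst p), encode (snd p))"
instance
proof
  show "inj (encode :: 'a \<times> 'b \<Rightarrow> nat)"
    using inj_encode[where 'a = 'a] inj_encode[where 'a = 'b]
    by (auto simp: inj_def prod_encode_eq)
qed
end

instantiation list :: (coded) coded
begin
text \<open>This agrees with \<open>word_code\<close> and \<open>tuple_code\<close>, so that an
  instance is numbered like a pair of nested lists of letter codes.\<close>

definition encode_list :: "'a list \<Rightarrow> nat" where "encode_list xs = list_encode (map encode xs)"
instance
proof
  have "inj (map (encode :: 'a \<Rightarrow> nat))" by (simp add: inj_encode)
  then show "inj (encode :: 'a list \<Rightarrow> nat)"
    unfolding encode_list_def inj_def by (simp add: list_encode_eq)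
qed
end

lemma encode_Nil [simp]: "encode [] = 0"
  and encode_Cons [simp]: "encode (x # xs) = Suc (prod_encode (encode x, encode xs))"
  by (simp_all add: encode_list_def)

lemma length_le_encode: "length xs \<le> encode xs"
proof (induction xs)
  case (Cons x xs)
  then show ?case using le_prod_encode_2[of "encode xs" "encode x"] by simp
qed simp

text \<open>On numbers that code no element of the domain the program may do anything, even
  diverge.\<close>

definition computable :: "('x::coded \<Rightarrow> 'y::coded) \<Rightarrow> bool" where
  "computable f \<longleftrightarrow> (\<exists>p. \<forall>x. computes p [encode x] (encode (f x)))"

named_theorems computable_intros

lemma computable_comp:
  assumes "computable g" "computable f"
  shows "computable (\<lambda>x. g (f x))"
proof -
  obtain p q where "\<And>x. computes p [encode x] (encode (f x))" "\<And>x. computes q [encode x] (encode (g x))"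
    using assms unfolding computable_def by blast
  then show ?thesis unfolding computable_def by (blast intro: computes_Comp1)
qed

text \<open>Programs see only codes, so results may change their type as long as the code stays;
  constants and \<open>Cons\<close> are obtained from functions into \<open>nat\<close> in this
  way.\<close>

lemma computable_same_encode:
  assumes "computable f" and "\<And>x. encode (g x) = encode (f x)"
  shows "computable g"
  using assms unfolding computable_def by simp

lemma computable_id [computable_intros]: "computable (\<lambda>x. x)"
  unfolding computable_def by (intro exI[of _ "Proj 0"] allI computes_Proj) simp_all

lemma computable_Suc [computable_intros]: "computable f \<Longrightarrow> computable (\<lambda>x. Suc (f x))"
  by (erule computable_comp[rotated])
    (unfold computable_def, intro exI[of _ Succ] allI, simp add: computes.Succ)

lemma computable_const [computable_intros]: "computable (\<lambda>x. c)"
proof -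
  have "computable (\<lambda>_. 0 :: nat)"
    unfolding computable_def by (intro exI[of _ Zero] allI) (simp add: computes.Zero)
  then have "computable (\<lambda>_. n :: nat)" for n
    by (induction n) (auto intro: computable_Suc)
  from this[of "encode c"] show ?thesis by (rule computable_same_encode) simp
qed

lemma computable_Pair [computable_intros]:
  assumes "computable f" "computable g"
  shows "computable (\<lambda>x. (f x, g x))"
proof -
  obtain p q where "\<And>x. computes p [encode x] (encode (f x))" "\<And>x. computes q [encode x] (encode (g x))"
    using assms unfolding computable_def by blast
  then have "computes (Comp pair_prog [p, q]) [encode x] (encode (f x, g x))" for x
    unfolding encode_prod_def fst_conv snd_conv by (intro computes_Comp2[OF _ _ computes_pair])
  then show ?thesis unfolding computable_def by blast
qed

lemma computable_fst [computable_intros]: "computable f \<Longrightarrow> computable (\<lambda>x. fst (f x))"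
  by (erule computable_comp[rotated])
    (unfold computable_def encode_prod_def, blast intro: computes_fst)

lemma computable_snd [computable_intros]: "computable f \<Longrightarrow> computable (\<lambda>x. snd (f x))"
  by (erule computable_comp[rotated])
    (unfold computable_def encode_prod_def, blast intro: computes_snd)

lemma computable_encode [computable_intros]: "computable f \<Longrightarrow> computable (\<lambda>x. encode (f x))"
  by (rule computable_same_encode[where f = f]) simp_all

lemma computable_rec_nat [computable_intros]:
  assumes "computable a" "computable m"
    and "computable (\<lambda>z. h (fst z) (fst (snd z)) (snd (snd z)))"
  shows "computable (\<lambda>x. rec_nat (a x) (h x) (m x))"
proof -
  obtain p q r where p: "\<And>x. computes p [encode x] (encode (a x))"
    and q: "\<And>x. computes q [encode x] (encode (m x))"
    and r: "\<And>z. computes r [encode z] (encode (h (fst z) (fst (snd z)) (snd (snd z))))"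
    using assms unfolding computable_def by blast
  \<comment> \<open>\<open>PrimRec\<close> hands over counter, value and parameter separately, in
    the order \<open>k\<close>, \<open>v\<close>, \<open>x\<close>; they are packed into the single
    code of \<open>(x, k, v)\<close> that \<open>r\<close> expects.\<close>
  let ?h = "Comp r [Comp pair_prog [Proj 2, Comp pair_prog [Proj 0, Proj 1]]]"
  have h: "computes ?h [k, encode v, encode x] (encode (h x k v))" for k v x
  proof (rule computes_Comp1)
    show "computes (Comp pair_prog [Proj 2, Comp pair_prog [Proj 0, Proj 1]]) [k, encode v, encode x]
      (encode (x, k, v))"
      unfolding encode_prod_def fst_conv snd_conv encode_nat_def
      by (intro computes_Comp2[OF _ _ computes_pair] computes_Proj) simp_all
    show "computes r [encode (x, k, v)] (encode (h x k v))"
      using r[of "(x, k, v)"] by simp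
  qed
  have "computes (PrimRec p ?h) [n, encode x] (encode (rec_nat (a x) (h x) n))" for n x
  proof (induction n)
    case (Suc n)
    show ?case using computes.PrimRec_Suc[OF Suc h] by simp
  qed (simp add: computes.PrimRec_0 p)
  then have "computes (Comp (PrimRec p ?h) [q, Proj 0]) [encode x] (encode (rec_nat (a x) (h x) (m x)))"
    for x
    using q[of x] by (intro computes_Comp2[of q]) (auto intro: computes_Proj)
  then show ?thesis unfolding computable_def by blast
qed

lemma computable_case_nat:
  assumes "computable a" "computable m" and "computable (\<lambda>z. h (fst z) (snd z))"
  shows "computable (\<lambda>x. case m x of 0 \<Rightarrow> a x | Suc k \<Rightarrow> h x k)"
proof -
  have "(case m x of 0 \<Rightarrow> a x | Suc k \<Rightarrow> h x k) = rec_nat (a x) (\<lambda>k _. h x k) (m x)" for x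
    by (cases "m x") simp_all
  moreover have "computable (\<lambda>x. rec_nat (a x) (\<lambda>k _. h x k) (m x))"
    using computable_comp[OF assms(3), of "\<lambda>z. (fst z, fst (snd z))"]
    by (intro computable_intros assms) (simp_all add: computable_intros)
  ultimately show ?thesis by simp
qed

lemma computable_If [computable_intros]:
  assumes "computable b" "computable f" "computable g"
  shows "computable (\<lambda>x. if b x then f x else g x)"
proof -
  have "computable (\<lambda>x. case encode (b x) of 0 \<Rightarrow> g x | Suc k \<Rightarrow> f x)"
    by (intro computable_case_nat computable_encode assms)
      (intro computable_comp[OF assms(2)] computable_intros)
  then show ?thesis by (simp add: of_bool_def if_distrib cong: if_cong)
qed

lemma computable_conj [computable_intros]:
  "computable f \<Longrightarrow> computable g \<Longrightarrow> computable (\<lambda>x. f x \<and> g x)"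
  by (rule computable_same_encode[OF computable_If[of f g "\<lambda>_. False"]]) (simp_all add: computable_const)

lemma computable_disj [computable_intros]:
  "computable f \<Longrightarrow> computable g \<Longrightarrow> computable (\<lambda>x. f x \<or> g x)"
  by (rule computable_same_encode[OF computable_If[of f "\<lambda>_. True" g]]) (simp_all add: computable_const)

lemma computable_Cons [computable_intros]:
  assumes "computable f" "computable g"
  shows "computable (\<lambda>x. f x # g x)"
  using computable_Suc[OF computable_encode[OF computable_Pair[OF assms]]]
  by (rule computable_same_encode) simp

text \<open>
  Composition is strict, and the program for the second branch may diverge on numbers that do not
  code anything.  It is therefore guarded by a recursion that runs only for a nonempty list.
\<close>

lemma computable_case_list [computable_intros]:
  assumes "computable l" "computable a"
    and h: "computable (\<lambda>z. h (fst z) (fst (snd z)) (snd (snd z)))"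
  shows "computable (\<lambda>x. case l x of [] \<Rightarrow> a x | y # ys \<Rightarrow> h x y ys)"
proof -
  obtain p q r where p: "\<And>x. computes p [encode x] (encode (a x))"
    and q: "\<And>x. computes q [encode x] (encode (l x))"
    and r: "\<And>z. computes r [encode z] (encode (h (fst z) (fst (snd z)) (snd (snd z))))"
    using assms unfolding computable_def by blast
  \<comment> \<open>The recursion counter is the sign of the code of the list, so at most one step
    is made; the predecessor of the code of \<open>y # ys\<close> is the code of
    \<open>(y, ys)\<close>.\<close>
  define c where "c = Comp (PrimRec (Comp p [Proj 0]) (Comp r [Comp pair_prog [Proj 2, Proj 3]]))
    [Comp sign_prog [q], Proj 0, Comp pred_prog [q]]"
  have "computes c [encode x] (encode (case l x of [] \<Rightarrow> a x | y # ys \<Rightarrow> h x y ys))" for x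
    unfolding c_def
  proof (rule computes.Comp)
    show "list_all2 (\<lambda>g. computes g [encode x]) [Comp sign_prog [q], Proj 0, Comp pred_prog [q]]
      [of_bool (encode (l x) > 0), encode x, encode (l x) - 1]"
      by (intro list.rel_intros computes_Comp1[OF q] computes_sign computes_pred computes_Proj)
        simp_all
    show "computes (PrimRec (Comp p [Proj 0]) (Comp r [Comp pair_prog [Proj 2, Proj 3]]))
      [of_bool (encode (l x) > 0), encode x, encode (l x) - 1]
      (encode (case l x of [] \<Rightarrow> a x | y # ys \<Rightarrow> h x y ys))"
    proof (cases "l x")
      case Nil
      then show ?thesis
        by (auto intro!: computes.PrimRec_0 computes_Comp1[OF _ p] computes_Proj)
    next
      case (Cons y ys)
      have "computes (Comp r [Comp pair_prog [Proj 2, Proj 3]]) [0, v, encode x, encode (y, ys)]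
        (encode (h x y ys))" for v
      proof (rule computes_Comp1)
        show "computes (Comp pair_prog [Proj 2, Proj 3]) [0, v, encode x, encode (y, ys)]
          (encode (x, y, ys))"
          unfolding encode_prod_def[of "(x, y, ys)"] fst_conv snd_conv
          by (intro computes_Comp2[OF _ _ computes_pair] computes_Proj) simp_all
        show "computes r [encode (x, y, ys)] (encode (h x y ys))"
          using r[of "(x, y, ys)"] by simp
      qed
      moreover have "computes (PrimRec (Comp p [Proj 0]) (Comp r [Comp pair_prog [Proj 2, Proj 3]]))
        [0, encode x, encode (y, ys)] (encode (a x))"
        by (auto intro!: computes.PrimRec_0 computes_Comp1[OF _ p] computes_Proj)
      ultimately show ?thesis
        using Cons by (auto intro: computes.PrimRec_Suc)
    qed
  qed
  then show ?thesis unfolding computable_def by blast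
qed

text \<open>A step that strips the head of the list, and rests once the list is empty, is iterated
  as often as the code of the list says. This suffices, since a list is no longer than its
  code.\<close>

lemma computable_fold [computable_intros]:
  assumes "computable l" "computable a"
    and g: "computable (\<lambda>z. g (fst z) (fst (snd z)) (snd (snd z)))"
  shows "computable (\<lambda>x. fold (g x) (l x) (a x))"
proof -
  define step where
    "step x s = (case fst s of [] \<Rightarrow> s | y # ys \<Rightarrow> (ys, g x y (snd s)))" for x s
  have step: "computable (\<lambda>z. step (fst z) (snd (snd z)))"
    unfolding step_def
    using computable_comp[OF g, of "\<lambda>z. (fst (fst z), fst (snd z), snd (snd (snd (fst z))))"]
    by (intro computable_intros) (simp_all add: computable_intros)
  have [simp]: "step x ([], s) = ([], s)" "step x (y # ys, s) = (ys, g x y s)" for x y ys s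
    by (simp_all add: step_def)
  have iterate: "rec_nat (ys, s) (\<lambda>_. step x) n = (drop n ys, fold (g x) (take n ys) s)" for x ys s n
  proof (induction n)
    case (Suc n)
    show ?case
    proof (cases "n < length ys")
      case True
      then show ?thesis
        by (simp add: Suc Cons_nth_drop_Suc[symmetric] take_Suc_conv_app_nth)
    qed (simp add: Suc)
  qed simp
  have "fold (g x) (l x) (a x) = snd (rec_nat (l x, a x) (\<lambda>_. step x) (encode (l x)))" for x
    by (simp add: iterate length_le_encode)
  moreover have "computable (\<lambda>x. snd (rec_nat (l x, a x) (\<lambda>_. step x) (encode (l x))))"
    by (intro computable_intros assms step)
  ultimately show ?thesis by simp
qed

section \<open>Standard operations on lists and numbers\<close>

lemma computable_rev [computable_intros]: "computable l \<Longrightarrow> computable (\<lambda>x. rev (l x))"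
  unfolding rev_conv_fold by (intro computable_intros)

lemma computable_foldr:
  assumes "computable l" "computable a"
    and "computable (\<lambda>z. g (fst z) (fst (snd z)) (snd (snd z)))"
  shows "computable (\<lambda>x. foldr (g x) (l x) (a x))"
  unfolding foldr_conv_fold by (intro computable_intros assms)

lemma foldr_Cons_append: "foldr Cons xs ys = xs @ ys"
  by (induction xs) simp_all

lemma computable_append [computable_intros]:
  assumes "computable f" "computable g"
  shows "computable (\<lambda>x. f x @ g x)"
  unfolding foldr_Cons_append[symmetric] by (intro computable_foldr computable_intros assms)

lemma computable_map [computable_intros]:
  assumes "computable l" and "computable (\<lambda>z. g (fst z) (snd z))"
  shows "computable (\<lambda>x. map (g x) (l x))"
proof -
  have "map (g x) ys = foldr (\<lambda>y. Cons (g x y)) ys []" for x ys by (induction ys) simp_all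
  moreover have "computable (\<lambda>z. g (fst z) (fst (snd z)))"
    using computable_comp[OF assms(2), of "\<lambda>z. (fst z, fst (snd z))"] by (simp add: computable_intros)
  ultimately show ?thesis by (simp only:) (intro computable_foldr computable_intros assms(1))
qed

lemma computable_concat [computable_intros]: "computable l \<Longrightarrow> computable (\<lambda>x. concat (l x))"
  unfolding concat_conv_foldr by (intro computable_foldr computable_intros)

lemma computable_list_all [computable_intros]:
  assumes "computable l" and "computable (\<lambda>z. P (fst z) (snd z))"
  shows "computable (\<lambda>x. list_all (P x) (l x))"
proof -
  have "list_all (P x) ys = foldr (\<lambda>y b. P x y \<and> b) ys True" for x ys by (induction ys) simp_all
  moreover have "computable (\<lambda>z. P (fst z) (fst (snd z)))"
    using computable_comp[OF assms(2), of "\<lambda>z. (fst z, fst (snd z))"] by (simp add: computable_intros)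
  ultimately show ?thesis by (simp only:) (intro computable_foldr computable_intros assms(1))
qed

lemma computable_list_ex [computable_intros]:
  assumes "computable l" and "computable (\<lambda>z. P (fst z) (snd z))"
  shows "computable (\<lambda>x. list_ex (P x) (l x))"
proof -
  have "list_ex (P x) ys = foldr (\<lambda>y b. P x y \<or> b) ys False" for x ys by (induction ys) simp_all
  moreover have "computable (\<lambda>z. P (fst z) (fst (snd z)))"
    using computable_comp[OF assms(2), of "\<lambda>z. (fst z, fst (snd z))"] by (simp add: computable_intros)
  ultimately show ?thesis by (simp only:) (intro computable_foldr computable_intros assms(1))
qed

lemma computable_length [computable_intros]:
  assumes "computable l" shows "computable (\<lambda>x. length (l x))"
proof -
  have "length ys = foldr (\<lambda>_. Suc) ys 0" for ys :: "'b list" by (induction ys) simp_all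
  then show ?thesis by (simp add: computable_foldr computable_intros assms)
qed

lemma computable_replicate [computable_intros]:
  assumes "computable n" "computable c" shows "computable (\<lambda>x. replicate (n x) (c x))"
proof -
  have "replicate k y = rec_nat [] (\<lambda>_. Cons y) k" for k and y :: 'b by (induction k) simp_all
  moreover have "computable (\<lambda>x. rec_nat [] (\<lambda>_. Cons (c x)) (n x))"
    using computable_comp[OF assms(2) computable_fst[OF computable_id]]
    by (intro computable_intros assms)
  ultimately show ?thesis by simp
qed

lemma computable_add [computable_intros]:
  assumes "computable f" "computable g" shows "computable (\<lambda>x. f x + g x :: nat)"
proof -
  have "m + n = rec_nat m (\<lambda>_. Suc) n" for m n :: nat by (induction n) simp_all
  then show ?thesis by (simp add: computable_intros assms)
qed

lemma computable_mult [computable_intros]: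
  assumes "computable f" "computable g" shows "computable (\<lambda>x. f x * g x :: nat)"
proof -
  have "m * n = rec_nat 0 (\<lambda>_. (+) m) n" for m n :: nat by (induction n) simp_all
  moreover have "computable (\<lambda>x. rec_nat 0 (\<lambda>_. (+) (f x)) (g x))"
    using computable_comp[OF assms(1) computable_fst[OF computable_id]]
    by (intro computable_intros assms)
  ultimately show ?thesis by simp
qed

lemma computable_power [computable_intros]:
  assumes "computable f" "computable g" shows "computable (\<lambda>x. f x ^ g x :: nat)"
proof -
  have "m ^ n = rec_nat 1 (\<lambda>_. (*) m) n" for m n :: nat by (induction n) simp_all
  moreover have "computable (\<lambda>x. rec_nat 1 (\<lambda>_. (*) (f x)) (g x))"
    using computable_comp[OF assms(1) computable_fst[OF computable_id]]
    by (intro computable_intros assms)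
  ultimately show ?thesis by simp
qed

section \<open>Finite tables and the passage to decidability\<close>

lemma computable_nat_table:
  fixes f :: "nat \<Rightarrow> 'y::coded"
  shows "\<exists>g. computable g \<and> (\<forall>i<n. g i = f i)"
proof (induction n arbitrary: f)
  case 0
  then show ?case by (blast intro: computable_const)
next
  case (Suc n)
  obtain g where g: "computable g" "\<forall>i<n. g i = f (Suc i)"
    using Suc[of "\<lambda>i. f (Suc i)"] by blast
  let ?g = "\<lambda>i. case i of 0 \<Rightarrow> f 0 | Suc k \<Rightarrow> g k"
  have "computable ?g"
    by (intro computable_case_nat computable_comp[OF g(1)] computable_intros)
  moreover have "\<forall>i<Suc n. ?g i = f i"
    using g(2) by (auto split: nat.split)
  ultimately show ?case by blast
qed

text \<open>A finite table can be written into a program. In this way the fixed Garside structure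
  becomes available to the algorithm.\<close>

lemma computable_on_finite:
  fixes f :: "'x::coded \<Rightarrow> 'y::coded"
  assumes "finite A"
  obtains g where "computable g" "\<And>x. x \<in> A \<Longrightarrow> g x = f x"
proof -
  obtain n where n: "encode ` A \<subseteq> {..<n}"
    using assms finite_nat_set_iff_bounded[of "encode ` A"] by auto
  obtain h where h: "computable h" "\<forall>i<n. h i = f (the_inv encode i)"
    using computable_nat_table[of n "\<lambda>i. f (the_inv encode i)"] by blast
  show ?thesis
  proof
    show "computable (\<lambda>x. h (encode x))"
      by (intro computable_comp[OF h(1)] computable_intros)
    show "h (encode x) = f x" if "x \<in> A" for x
      using that n h(2) by (auto simp: the_inv_f_f[OF inj_encode])
  qed
qed

text \<open>Links the coded types to a prescribed numbering \<open>c\<close> of inputs: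
  \<open>g\<close> replaces an input by data of a coded type that have the same number.\<close>

lemma decidable_on_computable:
  assumes "computable f" and "\<And>x. x \<in> I \<Longrightarrow> encode (g x) = c x" and "\<And>x. x \<in> I \<Longrightarrow> f (g x) = P x"
  shows "decidable_on c I P"
proof -
  obtain p where p: "\<And>y. computes p [encode y] (encode (f y))"
    using assms(1) unfolding computable_def by blast
  have "computes p [c x] (encode (P x))" if "x \<in> I" for x
    using p[of "g x"] assms(2,3)[OF that] by (simp del: encode_bool_def)
  then show ?thesis unfolding decidable_on_def encode_bool_def of_bool_def by blast
qed

section \<open>Divisibility in Garside groups\<close>

context garside_group
begin

section \<open>The positive monoid and its divisibility order\<close>

abbreviation positives ("P") where "P \<equiv> monoid_generate G S"

lemma carrier_positive_monoid [simp]: "carrier (positive_monoid G S) = P"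
  and mult_positive_monoid [simp]: "(\<otimes>\<^bsub>positive_monoid G S\<^esub>) = (\<otimes>)"
  and one_positive_monoid [simp]: "\<one>\<^bsub>positive_monoid G S\<^esub> = \<one>"
  by (simp_all add: positive_monoid_def)

lemma simple_closed [simp]: "s \<in> S \<Longrightarrow> s \<in> carrier G"
  using simples_closed by blast

lemma positive_closed [simp]: "x \<in> P \<Longrightarrow> x \<in> carrier G"
  by (induction rule: monoid_generate.induct) simp_all

lemma one_positive [simp]: "\<one> \<in> P"
  and simple_positive [simp]: "s \<in> S \<Longrightarrow> s \<in> P"
  and mult_positive [simp]: "x \<in> P \<Longrightarrow> y \<in> P \<Longrightarrow> x \<otimes> y \<in> P"
  by (auto intro: monoid_generate.intros)

lemma pow_positive [simp]: "x \<in> P \<Longrightarrow> x [^] (n::nat) \<in> P"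
  by (induction n) simp_all

lemma Delta_in_positives [simp]: "\<Delta> \<in> P"
  using Delta_positive by simp

text \<open>With \<open>P\<close> as positive cone, left divisibility extends to a relation on the
  whole group that is invariant under left translation.\<close>

definition le :: "'a \<Rightarrow> 'a \<Rightarrow> bool" (infix "\<preceq>" 50) where
  "a \<preceq> b \<longleftrightarrow> inv a \<otimes> b \<in> P"

lemma cancel_left [simp]: "x \<in> carrier G \<Longrightarrow> y \<in> carrier G \<Longrightarrow> inv x \<otimes> (x \<otimes> y) = y"
  and cancel_left' [simp]: "x \<in> carrier G \<Longrightarrow> y \<in> carrier G \<Longrightarrow> x \<otimes> (inv x \<otimes> y) = y"
  by (simp_all add: m_assoc[symmetric])

lemma le_iff: "a \<in> carrier G \<Longrightarrow> b \<in> carrier G \<Longrightarrow> a \<preceq> b \<longleftrightarrow> (\<exists>c\<in>P. b = a \<otimes> c)"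
  unfolding le_def by (metis cancel_left cancel_left' inv_closed positive_closed)

lemma divides_iff_le:
  "a \<in> P \<Longrightarrow> b \<in> P \<Longrightarrow> a divides\<^bsub>positive_monoid G S\<^esub> b \<longleftrightarrow> a \<preceq> b"
  by (simp add: le_iff factor_def)

lemma le_mult [simp]: "a \<in> carrier G \<Longrightarrow> c \<in> P \<Longrightarrow> a \<preceq> a \<otimes> c"
  by (simp add: le_def)

lemma prec_refl [simp]: "a \<in> carrier G \<Longrightarrow> a \<preceq> a"
  by (simp add: le_def)

lemma one_le [simp]: "x \<in> P \<Longrightarrow> \<one> \<preceq> x"
  by (simp add: le_def)

lemma prec_trans:
  assumes "a \<preceq> b" "b \<preceq> c" and [simp]: "a \<in> carrier G" "b \<in> carrier G" "c \<in> carrier G"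
  shows "a \<preceq> c"
  using mult_positive[OF assms(1,2)[unfolded le_def]] by (simp add: le_def m_assoc)

lemma mult_le_mult_iff [simp]:
  "a \<in> carrier G \<Longrightarrow> b \<in> carrier G \<Longrightarrow> c \<in> carrier G \<Longrightarrow> a \<otimes> b \<preceq> a \<otimes> c \<longleftrightarrow> b \<preceq> c"
  by (simp add: le_def inv_mult_group m_assoc)

lemma list_prod_append:
  "set xs \<subseteq> carrier G \<Longrightarrow> set ys \<subseteq> carrier G \<Longrightarrow>
    list_prod G (xs @ ys) = list_prod G xs \<otimes> list_prod G ys"
  and list_prod_closed [simp]: "set xs \<subseteq> carrier G \<Longrightarrow> list_prod G xs \<in> carrier G"
proof -
  show closed: "set xs \<subseteq> carrier G \<Longrightarrow> list_prod G xs \<in> carrier G" for xs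
    by (induction xs) (simp_all add: list_prod_def)
  show "set xs \<subseteq> carrier G \<Longrightarrow> set ys \<subseteq> carrier G \<Longrightarrow>
    list_prod G (xs @ ys) = list_prod G xs \<otimes> list_prod G ys"
    using closed by (induction xs) (simp_all add: list_prod_def m_assoc)
qed

lemma list_prod_Nil [simp]: "list_prod G [] = \<one>"
  and list_prod_Cons [simp]: "list_prod G (x # xs) = x \<otimes> list_prod G xs"
  by (simp_all add: list_prod_def)

section \<open>Absence of nontrivial units, antisymmetry and lcms\<close>

lemma noetherian:
  assumes "a \<in> P"
  obtains n where "\<And>xs. set xs \<subseteq> P - {\<one>} \<Longrightarrow> list_prod G xs = a \<Longrightarrow> length xs \<le> n"
proof -
  have "list_prod (positive_monoid G S) xs = list_prod G xs" for xs
    by (simp add: list_prod_def[abs_def])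
  then have "\<exists>n. \<forall>xs. set xs \<subseteq> P - {\<one>} \<and> list_prod G xs = a \<longrightarrow> length xs \<le> n"
    using gaussian assms unfolding gaussian_monoid_def noetherian_monoid_def by simp
  then show ?thesis using that by blast
qed

text \<open>Otherwise the products \<open>x y x y ...\<close> would be arbitrarily long
  factorisations of \<open>\<one>\<close> into nonidentity elements.\<close>

lemma positive_mult_eq_one:
  assumes x: "x \<in> P" and y: "y \<in> P" and xy: "x \<otimes> y = \<one>"
  shows "x = \<one>"
proof (rule ccontr)
  assume "x \<noteq> \<one>"
  moreover from this have "y \<noteq> \<one>" using assms by auto
  ultimately have set: "set (concat (replicate k [x, y])) \<subseteq> P - {\<one>}" for k
    using x y by auto
  obtain n where n: "\<And>xs. set xs \<subseteq> P - {\<one>} \<Longrightarrow> list_prod G xs = \<one> \<Longrightarrow> length xs \<le> n"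
    using noetherian[of \<one>] by auto
  have "list_prod G (concat (replicate k [x, y])) = \<one>" for k
    using x y xy by (induction k) simp_all
  then have "length (concat (replicate (Suc n) [x, y])) \<le> n"
    by (intro n set)
  moreover have "length (concat (replicate k [x, y])) = 2 * k" for k
    by (induction k) simp_all
  ultimately show False by simp
qed

lemma positive_mult_eq_one_iff:
  "x \<in> P \<Longrightarrow> y \<in> P \<Longrightarrow> x \<otimes> y = \<one> \<longleftrightarrow> x = \<one> \<and> y = \<one>"
  by (metis positive_mult_eq_one l_one positive_closed one_closed)

text \<open>The two quotients are positive and inverse to each other, hence trivial.\<close>

lemma prec_antisym:
  assumes "a \<preceq> b" "b \<preceq> a" and [simp]: "a \<in> carrier G" "b \<in> carrier G"
  shows "a = b"
proof -
  have "(inv a \<otimes> b) \<otimes> (inv b \<otimes> a) = \<one>" by (simp add: m_assoc)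
  then have "inv a \<otimes> b = \<one>"
    using assms(1,2) unfolding le_def by (rule positive_mult_eq_one[rotated 2])
  then show ?thesis using cancel_left'[of a b] by simp
qed

lemma le_one_iff: "x \<in> P \<Longrightarrow> x \<preceq> \<one> \<longleftrightarrow> x = \<one>"
  using prec_antisym[of x \<one>] by auto

lemma positive_lcm:
  assumes "a \<in> P" "b \<in> P"
  obtains m where "m \<in> P" "a \<preceq> m" "b \<preceq> m" "\<And>m'. m' \<in> P \<Longrightarrow> a \<preceq> m' \<Longrightarrow> b \<preceq> m' \<Longrightarrow> m \<preceq> m'"
proof -
  obtain m where "is_right_lcm (positive_monoid G S) a b m"
    using gaussian assms unfolding gaussian_monoid_def by fastforce
  then show ?thesis
    using that assms unfolding is_right_lcm_def is_lub_def
    by (auto simp: divides_iff_le)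
qed

section \<open>Simple elements and conjugation by \<Delta>\<close>

lemma simple_iff_le: "s \<in> S \<longleftrightarrow> s \<in> P \<and> s \<preceq> \<Delta>"
  by (subst simples_divisors) (auto simp: left_divisors_def divides_iff_le)

lemma simple_iff_right: "s \<in> S \<longleftrightarrow> s \<in> P \<and> \<Delta> \<otimes> inv s \<in> P"
proof -
  have "S = right_divisors (positive_monoid G S) \<Delta>"
    using Delta_balanced simples_divisors unfolding balanced_def by simp
  also have "\<dots> = {s \<in> P. \<Delta> \<otimes> inv s \<in> P}"
  proof -
    have "(\<exists>c\<in>P. \<Delta> = c \<otimes> s) \<longleftrightarrow> \<Delta> \<otimes> inv s \<in> P" if "s \<in> P" for s
      using that by (auto simp: m_assoc intro: bexI[of _ "\<Delta> \<otimes> inv s"])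
    then show ?thesis by (auto simp: right_divisors_def right_divides_def)
  qed
  finally show ?thesis by blast
qed

lemma one_simple [simp]: "\<one> \<in> S"
  by (subst simple_iff_le) simp

lemma Delta_simple [simp]: "\<Delta> \<in> S"
  by (subst simple_iff_le) simp

text \<open>The complement is a right divisor of \<Delta>, with quotient \<open>s\<close>, and right
  divisors of the balanced element \<Delta> are simple.\<close>

lemma simple_right_complement:
  assumes "s \<in> S" shows "inv s \<otimes> \<Delta> \<in> S"
proof -
  have "inv s \<otimes> \<Delta> \<in> P" using assms simple_iff_le le_def by blast
  moreover have "\<Delta> \<otimes> inv (inv s \<otimes> \<Delta>) = s"
    using assms by (simp add: inv_mult_group)
  ultimately show ?thesis using assms simple_iff_right[of "inv s \<otimes> \<Delta>"] by simp
qed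

lemma simple_left_complement:
  assumes "s \<in> S" shows "\<Delta> \<otimes> inv s \<in> S"
proof -
  have "\<Delta> \<otimes> inv s \<in> P" using assms simple_iff_right by blast
  moreover have "inv (\<Delta> \<otimes> inv s) \<otimes> \<Delta> = s"
    using assms by (simp add: inv_mult_group m_assoc)
  ultimately show ?thesis using assms simple_iff_le[of "\<Delta> \<otimes> inv s"] by (simp add: le_def)
qed

text \<open>Conjugation by \<Delta> amounts to taking the right complement twice.\<close>

lemma simple_conj_Delta: "s \<in> S \<Longrightarrow> inv \<Delta> \<otimes> s \<otimes> \<Delta> \<in> S"
  using simple_right_complement[OF simple_right_complement, of s]
  by (simp add: inv_mult_group)

lemma positive_conj_Delta: "x \<in> P \<Longrightarrow> inv \<Delta> \<otimes> x \<otimes> \<Delta> \<in> P"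
proof (induction rule: monoid_generate.induct)
  case (mult x y)
  have "inv \<Delta> \<otimes> (x \<otimes> y) \<otimes> \<Delta> = (inv \<Delta> \<otimes> x \<otimes> \<Delta>) \<otimes> (inv \<Delta> \<otimes> y \<otimes> \<Delta>)"
    using mult.hyps by (simp add: m_assoc)
  with mult.IH show ?case by simp
qed (simp_all add: simple_conj_Delta)

lemma Delta_le_mult_Delta: "x \<in> P \<Longrightarrow> \<Delta> \<preceq> x \<otimes> \<Delta>"
  using positive_conj_Delta by (simp add: le_def m_assoc)

text \<open>Conjugation by powers of \<Delta> acts on the finite set \<open>S\<close>, so two
  different powers act alike. Their quotient commutes with \<open>S\<close>, hence with
  \<open>P\<close> and with all fractions.\<close>

lemma Delta_power_central:
  obtains e :: nat where "e > 0" "\<And>g. g \<in> carrier G \<Longrightarrow> \<Delta> [^] e \<otimes> g = g \<otimes> \<Delta> [^] e"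
proof -
  define f where "f n = (\<lambda>s\<in>S. inv (\<Delta> [^] n) \<otimes> s \<otimes> \<Delta> [^] n)" for n :: nat
  have conj: "inv (\<Delta> [^] n) \<otimes> s \<otimes> \<Delta> [^] n \<in> S" if "s \<in> S" for n :: nat and s
  proof (induction n)
    case (Suc n)
    from simple_conj_Delta[OF Suc] show ?case
      using that by (simp add: inv_mult_group m_assoc)
  qed (use that in simp)
  then have "range f \<subseteq> S \<rightarrow>\<^sub>E S" by (auto simp: f_def)
  then have "finite (range f)"
    using simples_finite by (meson finite_PiE finite_subset)
  then have "\<not> inj f" using finite_imageD[of f UNIV] by auto
  then obtain i j where ij: "i < j" "f i = f j"
    unfolding inj_def by (metis linorder_neqE_nat)
  let ?z = "\<Delta> [^] (j - i)"
  have j: "\<Delta> [^] j = \<Delta> [^] i \<otimes> ?z" "\<Delta> [^] j = ?z \<otimes> \<Delta> [^] i"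
    using ij(1) by (simp_all add: nat_pow_mult)
  have S: "?z \<otimes> s = s \<otimes> ?z" if s: "s \<in> S" for s
  proof -
    have "inv (\<Delta> [^] i) \<otimes> s \<otimes> \<Delta> [^] i = inv (\<Delta> [^] j) \<otimes> s \<otimes> \<Delta> [^] j"
      using fun_cong[OF ij(2), of s] s by (simp add: f_def)
    also have "\<dots> = inv (\<Delta> [^] i) \<otimes> (inv ?z \<otimes> s \<otimes> ?z) \<otimes> \<Delta> [^] i"
      unfolding j(2) using s by (simp add: inv_mult_group m_assoc)
    finally have "s \<otimes> \<Delta> [^] i = (inv ?z \<otimes> s \<otimes> ?z) \<otimes> \<Delta> [^] i"
      using s by (simp add: m_assoc)
    then have "s = inv ?z \<otimes> s \<otimes> ?z" by (rule r_cancel) (use s in simp_all)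
    then have "?z \<otimes> s = ?z \<otimes> (inv ?z \<otimes> s \<otimes> ?z)" by simp
    then show ?thesis using s by (simp add: m_assoc)
  qed
  have P: "?z \<otimes> x = x \<otimes> ?z" if "x \<in> P" for x
    using that
  proof (induction rule: monoid_generate.induct)
    case (mult x y)
    then show ?case by (metis Delta_in_positives m_assoc nat_pow_closed positive_closed)
  qed (simp_all add: S)
  show ?thesis
  proof
    show "j - i > 0" using ij(1) by simp
    fix g assume "g \<in> carrier G"
    then obtain a b where ab: "a \<in> P" "b \<in> P" "g = a \<otimes> inv b"
      using fractions unfolding group_of_fractions_def by blast
    have "?z \<otimes> inv b = inv b \<otimes> ?z"
      using P[OF ab(2)] ab(2)
      by (metis Delta_in_positives inv_solve_left inv_solve_right m_assoc m_closed inv_closed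
          nat_pow_closed positive_closed)
    then show "?z \<otimes> g = g \<otimes> ?z"
      using P[OF ab(1)] ab by (metis Delta_in_positives m_assoc inv_closed nat_pow_closed positive_closed)
  qed
qed

section \<open>The left gcd with \<Delta>\<close>

text \<open>The lcm of two simple divisors of \<open>x\<close> divides both \<Delta> and
  \<open>x\<close>, so it is another simple divisor of \<open>x\<close>. Taking for \<open>F\<close>
  all simple divisors of \<open>x\<close> yields the gcd of \<open>x\<close> and \<Delta>.\<close>

lemma simple_upper_bound:
  assumes x: "x \<in> P" and "F \<subseteq> {s \<in> S. s \<preceq> x}"
  shows "\<exists>d\<in>S. d \<preceq> x \<and> (\<forall>t\<in>F. t \<preceq> d)"
proof -
  have "finite F" using assms(2) simples_finite by (auto intro: finite_subset)
  then show ?thesis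
    using assms(2)
  proof (induction F rule: finite_induct)
    case empty
    show ?case using x by (intro bexI[of _ \<one>]) simp_all
  next
    case (insert s F)
    then obtain d where d: "d \<in> S" "d \<preceq> x" "\<forall>t\<in>F. t \<preceq> d" by blast
    have s: "s \<in> S" "s \<preceq> x" using insert.prems by auto
    obtain m where m: "m \<in> P" "s \<preceq> m" "d \<preceq> m" "\<And>m'. m' \<in> P \<Longrightarrow> s \<preceq> m' \<Longrightarrow> d \<preceq> m' \<Longrightarrow> m \<preceq> m'"
      using positive_lcm[of s d] s d by auto
    have "m \<in> S"
      using m s d by (metis simple_iff_le Delta_in_positives)
    moreover have "m \<preceq> x" using m x s d by blast
    moreover have "t \<preceq> m" if "t \<in> F" for t
      using prec_trans[of t d m] that d m insert.prems by auto
    ultimately show ?case using m(2) by (intro bexI[of _ m]) auto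
  qed
qed

text \<open>Since \<open>S\<close> consists of the divisors of \<Delta>, this is the left gcd of
  \<open>x\<close> and \<Delta>, the first factor of the greedy normal form.\<close>

definition is_head :: "'a \<Rightarrow> 'a \<Rightarrow> bool" where
  "is_head d x \<longleftrightarrow> d \<in> S \<and> d \<preceq> x \<and> (\<forall>t\<in>S. t \<preceq> x \<longrightarrow> t \<preceq> d)"

lemma head_exists:
  assumes "x \<in> P" obtains d where "is_head d x"
  using simple_upper_bound[OF assms order_refl] unfolding is_head_def by blast

text \<open>Left multiplication by \<open>a\<close> distributes over the gcd \<open>d\<close> of \<open>x\<close> and \<open>\<Delta>\<close>.\<close>

lemma le_mult_head:
  assumes d: "is_head d x" and P: "a \<in> P" "x \<in> P" "t \<in> P"
    and "t \<preceq> a \<otimes> x" "t \<preceq> a \<otimes> \<Delta>"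
  shows "t \<preceq> a \<otimes> d"
proof -
  \<comment> \<open>In general \<open>a\<close> does not divide \<open>t\<close>; passing to the lcm
    of the two makes it possible to cancel \<open>a\<close>.\<close>
  obtain m where m: "m \<in> P" "t \<preceq> m" "a \<preceq> m" "\<And>m'. m' \<in> P \<Longrightarrow> t \<preceq> m' \<Longrightarrow> a \<preceq> m' \<Longrightarrow> m \<preceq> m'"
    using positive_lcm[of t a] P by auto
  obtain n where n: "n \<in> P" "m = a \<otimes> n" using m P by (auto simp: le_iff)
  have "m \<preceq> a \<otimes> x" "m \<preceq> a \<otimes> \<Delta>" using m(4) assms by simp_all
  then have "n \<preceq> x" "n \<preceq> \<Delta>" using n P by simp_all
  then have "n \<preceq> d" using d n by (auto simp: is_head_def simple_iff_le)
  moreover have "d \<in> carrier G" using d by (simp add: is_head_def)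
  ultimately show ?thesis using prec_trans[of t m "a \<otimes> d"] m n P by simp
qed

text \<open>Positivity of the conjugate means \<open>d \<preceq> a \<otimes> d\<close>. Here
  \<open>d \<preceq> x \<preceq> a \<otimes> x\<close> by the assumption on \<open>x\<close>, and
  \<open>d \<preceq> \<Delta> \<preceq> a \<otimes> \<Delta>\<close>; the gcd property does the
  rest.\<close>

lemma conj_head_positive:
  assumes d: "is_head d x" and P: "a \<in> P" "x \<in> P" and "inv x \<otimes> a \<otimes> x \<in> P"
  shows "inv d \<otimes> a \<otimes> d \<in> P"
proof -
  have d': "d \<in> S" "d \<preceq> x" "d \<preceq> \<Delta>" using d by (auto simp: is_head_def simple_iff_le)
  have "x \<preceq> a \<otimes> x" using assms by (simp add: le_def m_assoc)
  then have "d \<preceq> a \<otimes> x" using prec_trans[of d x] d' P by simp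
  moreover have "d \<preceq> a \<otimes> \<Delta>" using prec_trans[of d \<Delta>] d' P Delta_le_mult_Delta by simp
  ultimately have "d \<preceq> a \<otimes> d" using le_mult_head[OF d P, of d] d' by simp
  then show ?thesis using d' P by (simp add: le_def m_assoc)
qed

text \<open>A nontrivial product of simple elements is divisible by its first nontrivial
  factor.\<close>

lemma head_eq_one:
  assumes "is_head \<one> x" "x \<in> P"
  shows "x = \<one>"
proof -
  have "x \<noteq> \<one> \<Longrightarrow> \<exists>s\<in>S. s \<noteq> \<one> \<and> s \<preceq> x"
    using assms(2)
  proof (induction rule: monoid_generate.induct)
    case (incl s)
    then show ?case by (intro bexI[of _ s]) simp_all
  next
    case (mult x y)
    show ?case
    proof (cases "x = \<one>")
      case False
      then obtain s where "s \<in> S" "s \<noteq> \<one>" "s \<preceq> x" using mult by blast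
      then show ?thesis using mult.hyps prec_trans[of s x "x \<otimes> y"] by auto
    qed (use mult in simp)
  qed simp
  then show ?thesis using assms(1) by (auto simp: is_head_def le_one_iff)
qed

text \<open>For a divisor \<open>b\<close> of the power \<open>Suc n\<close>, the lcm of
  \<open>b\<close> and \<Delta> is \<open>b \<otimes> t = \<Delta> \<otimes> m\<close>. It divides
  that power, so \<open>m\<close> divides the power \<open>n\<close>; it divides
  \<open>b \<otimes> \<Delta>\<close>, so \<open>t\<close> is simple. As \<open>b\<close> is
  determined by \<open>m\<close> and \<open>t\<close>, each step costs a factor
  \<open>card S\<close>.\<close>

lemma finite_divisors_Delta_power:
  "finite {b \<in> P. b \<preceq> \<Delta> [^] n} \<and> card {b \<in> P. b \<preceq> \<Delta> [^] (n::nat)} \<le> card S ^ n"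
proof (induction n)
  case 0
  have "{b \<in> P. b \<preceq> \<Delta> [^] (0::nat)} = {\<one>}" by (auto simp: le_one_iff)
  then show ?case by simp
next
  case (Suc n)
  let ?D = "\<lambda>n. {b \<in> P. b \<preceq> \<Delta> [^] (n::nat)}"
  have "?D (Suc n) \<subseteq> (\<lambda>(m, t). \<Delta> \<otimes> m \<otimes> inv t) ` (?D n \<times> S)"
  proof
    fix b assume "b \<in> ?D (Suc n)"
    then have b: "b \<in> P" "b \<preceq> \<Delta> [^] Suc n" by auto
    obtain c where c: "c \<in> P" "b \<preceq> c" "\<Delta> \<preceq> c" "\<And>m'. m' \<in> P \<Longrightarrow> b \<preceq> m' \<Longrightarrow> \<Delta> \<preceq> m' \<Longrightarrow> c \<preceq> m'"
      using positive_lcm[of b \<Delta>] b by auto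
    obtain t m where t: "t \<in> P" "c = b \<otimes> t" and m: "m \<in> P" "c = \<Delta> \<otimes> m"
      using b c by (auto simp: le_iff)
    have Suc_eq: "\<Delta> [^] Suc n = \<Delta> \<otimes> \<Delta> [^] n" by (rule nat_pow_Suc2) simp
    have "c \<preceq> \<Delta> [^] Suc n" by (intro c(4) b(2)) (simp_all only: Suc_eq, simp_all)
    then have "m \<preceq> \<Delta> [^] n" using m(1) unfolding m(2) Suc_eq by simp
    moreover have "c \<preceq> b \<otimes> \<Delta>" using c(4)[of "b \<otimes> \<Delta>"] b by (simp add: Delta_le_mult_Delta)
    then have "t \<in> S" using t b by (simp add: simple_iff_le)
    moreover have "b = \<Delta> \<otimes> m \<otimes> inv t" using t b m by (metis inv_solve_right m_closed positive_closed)
    ultimately show "b \<in> (\<lambda>(m, t). \<Delta> \<otimes> m \<otimes> inv t) ` (?D n \<times> S)" using m by force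
  qed
  moreover have "finite (?D n \<times> S)" using Suc simples_finite by simp
  moreover have "card (?D n \<times> S) \<le> card S ^ Suc n" using Suc by (simp add: card_cartesian_product)
  ultimately show ?case
    by (meson finite_imageI finite_subset order_trans surj_card_le)
qed

section \<open>Conjugation of elements and tuples\<close>

definition conj_by :: "'a \<Rightarrow> 'a \<Rightarrow> 'a" where
  "conj_by x a = inv x \<otimes> a \<otimes> x"

lemma conj_by_closed [simp]: "x \<in> carrier G \<Longrightarrow> a \<in> carrier G \<Longrightarrow> conj_by x a \<in> carrier G"
  by (simp add: conj_by_def)

lemma conj_by_one [simp]: "a \<in> carrier G \<Longrightarrow> conj_by \<one> a = a"
  by (simp add: conj_by_def)

lemma conj_by_mult:
  "x \<in> carrier G \<Longrightarrow> y \<in> carrier G \<Longrightarrow> a \<in> carrier G \<Longrightarrow> conj_by (x \<otimes> y) a = conj_by y (conj_by x a)"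
  by (simp add: conj_by_def inv_mult_group m_assoc)

lemma inv_conj_by: "x \<in> carrier G \<Longrightarrow> a \<in> carrier G \<Longrightarrow> inv (conj_by x a) = conj_by x (inv a)"
  by (simp add: conj_by_def inv_mult_group m_assoc)

lemma conj_by_eq_iff:
  assumes [simp]: "x \<in> carrier G" "a \<in> carrier G" "c \<in> carrier G"
  shows "conj_by x a = c \<longleftrightarrow> a \<otimes> x = x \<otimes> c"
  unfolding conj_by_def by (metis assms cancel_left cancel_left' inv_closed m_assoc m_closed)

lemma simultaneously_conjugate_iff:
  "simultaneously_conjugate G as cs \<longleftrightarrow> (\<exists>x\<in>carrier G. cs = map (conj_by x) as)"
proof -
  have "cs = map (conj_by x) as \<longleftrightarrow>
    length as = length cs \<and> (\<forall>i<length as. inv x \<otimes> as ! i \<otimes> x = cs ! i)" for x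
    by (auto simp: list_eq_iff_nth_eq conj_by_def)
  then show ?thesis by (auto simp: simultaneously_conjugate_def)
qed

end

section \<open>Intervals bounded by powers of a central element\<close>

locale central_garside_group = garside_group +
  fixes e :: nat
  assumes e_pos: "e > 0"
    and Delta_pow_central: "g \<in> carrier G \<Longrightarrow> \<Delta> [^] e \<otimes> g = g \<otimes> \<Delta> [^] e"
begin

abbreviation Z where "Z \<equiv> \<Delta> [^] e"

lemma Z_pow_central: "g \<in> carrier G \<Longrightarrow> Z [^] (k::nat) \<otimes> g = g \<otimes> Z [^] k"
proof (induction k)
  case (Suc k)
  then have "Z [^] Suc k \<otimes> g = Z [^] k \<otimes> (g \<otimes> Z)"
    by (simp add: m_assoc Delta_pow_central)
  also have "\<dots> = g \<otimes> Z [^] Suc k"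
    using Suc by (simp add: m_assoc[symmetric])
  finally show ?case .
qed simp

text \<open>As \<open>Z\<close> is central, the two conditions say that \<open>a\<close> lies
  between \<open>inv (Z [^] k)\<close> and \<open>Z [^] k\<close> for
  \<open>\<preceq>\<close>.\<close>

definition interval :: "nat \<Rightarrow> 'a set" where
  "interval k = {a \<in> carrier G. Z [^] k \<otimes> a \<in> P \<and> Z [^] k \<otimes> inv a \<in> P}"

lemma interval_closed: "a \<in> interval k \<Longrightarrow> a \<in> carrier G"
  by (simp add: interval_def)

lemma positive_mult_Z_pow:
  assumes "x \<in> carrier G" "y \<in> carrier G" "Z [^] (k::nat) \<otimes> x \<in> P" "Z [^] (l::nat) \<otimes> y \<in> P"
  shows "Z [^] (k + l) \<otimes> (x \<otimes> y) \<in> P"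
proof -
  have "Z [^] (k + l) \<otimes> (x \<otimes> y) = Z [^] k \<otimes> (Z [^] l \<otimes> x) \<otimes> y"
    using assms(1,2) by (simp add: nat_pow_mult[symmetric] m_assoc)
  also have "\<dots> = (Z [^] k \<otimes> x) \<otimes> (Z [^] l \<otimes> y)"
    using assms(1,2) by (simp add: Z_pow_central[of x l] m_assoc)
  finally show ?thesis using mult_positive[OF assms(3,4)] by simp
qed

lemma interval_mult: "a \<in> interval k \<Longrightarrow> b \<in> interval l \<Longrightarrow> a \<otimes> b \<in> interval (k + l)"
  using positive_mult_Z_pow[of a b k l] positive_mult_Z_pow[of "inv b" "inv a" l k]
  by (simp add: interval_def inv_mult_group add.commute)

lemma one_in_interval: "\<one> \<in> interval k"
  by (simp add: interval_def)

lemma interval_mono: "k \<le> l \<Longrightarrow> interval k \<subseteq> interval l"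
  using interval_mult[OF _ one_in_interval[of "l - k"], of _ k] by (fastforce dest: interval_closed)

lemma Z_inv_simple:
  assumes "s \<in> S" shows "Z \<otimes> inv s \<in> P"
proof -
  have "Z = \<Delta> [^] (e - 1) \<otimes> \<Delta>"
    using e_pos by (cases e) simp_all
  then have "Z \<otimes> inv s = \<Delta> [^] (e - 1) \<otimes> (\<Delta> \<otimes> inv s)" using assms by (simp add: m_assoc)
  then show ?thesis using simple_left_complement[OF assms] by simp
qed

lemma letter_in_interval: "l \<in> S \<times> UNIV \<Longrightarrow> letter_value G l \<in> interval 1"
  using Z_inv_simple by (auto simp: letter_value_def interval_def)

text \<open>Letters lie in \<open>interval 1\<close>, and bounds add up under multiplication. An
  admissible \<open>k\<close> can thus be read off the input words.\<close>

lemma word_in_interval: "w \<in> words S \<Longrightarrow> word_value G w \<in> interval (length w)"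
proof (induction w)
  case Nil
  then show ?case by (simp add: word_value_def one_in_interval)
next
  case (Cons l w)
  then have "letter_value G l \<otimes> word_value G w \<in> interval (1 + length w)"
    by (intro interval_mult letter_in_interval Cons.IH) (simp_all add: words_def)
  then show ?case by (simp add: word_value_def)
qed

text \<open>Multiplication by \<open>Z [^] k\<close> maps the interval injectively into the divisors
  of \<open>Z [^] (2 * k)\<close>, a power of \<Delta> with exponent
  \<open>e * (2 * k)\<close>.\<close>

lemma card_interval: "finite (interval k) \<and> card (interval k) \<le> card S ^ (e * (2 * k))"
proof -
  let ?D = "{b \<in> P. b \<preceq> \<Delta> [^] (e * (2 * k))}"
  have Z: "\<Delta> [^] (e * (2 * k)) = Z [^] k \<otimes> Z [^] k"
    by (simp add: nat_pow_pow[symmetric] nat_pow_mult mult_2)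
  have "Z [^] k \<otimes> a \<in> ?D" if "a \<in> interval k" for a
  proof -
    have "inv (Z [^] k \<otimes> a) \<otimes> (Z [^] k \<otimes> Z [^] k) = Z [^] k \<otimes> inv a"
      using that Z_pow_central[of "inv a" k] by (simp add: interval_def inv_mult_group m_assoc)
    then show ?thesis using that by (simp add: Z le_def interval_def)
  qed
  then have "(\<lambda>a. Z [^] k \<otimes> a) ` interval k \<subseteq> ?D" by blast
  moreover have inj: "inj_on (\<lambda>a. Z [^] k \<otimes> a) (interval k)"
    by (intro inj_onI) (metis Delta_in_positives interval_closed l_cancel nat_pow_closed positive_closed)
  ultimately have "finite (interval k)" "card (interval k) \<le> card ?D"
    using finite_divisors_Delta_power[of "e * (2 * k)"]
    by (auto intro: inj_on_finite card_inj_on_le)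
  then show ?thesis
    using finite_divisors_Delta_power[of "e * (2 * k)"] by linarith
qed

lemma ex_Z_pow_inv_positive: "b \<in> P \<Longrightarrow> \<exists>k::nat. Z [^] k \<otimes> inv b \<in> P"
proof (induction rule: monoid_generate.induct)
  case one
  show ?case by (intro exI[of _ 0]) simp
next
  case (incl s)
  then show ?case by (intro exI[of _ 1]) (simp add: Z_inv_simple)
next
  case (mult x y)
  then obtain k l :: nat where "Z [^] k \<otimes> inv x \<in> P" "Z [^] l \<otimes> inv y \<in> P" by blast
  then have "Z [^] (l + k) \<otimes> (inv y \<otimes> inv x) \<in> P"
    using mult.hyps by (intro positive_mult_Z_pow) simp_all
  then show ?case using mult.hyps by (auto simp: inv_mult_group)
qed

text \<open>A sufficiently high power of \<open>Z\<close> clears the denominator of the fraction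
  \<open>x\<close>, and being central it does not affect conjugation.\<close>

lemma positive_conjugator:
  assumes "x \<in> carrier G"
  obtains y where "y \<in> P" "\<And>a. a \<in> carrier G \<Longrightarrow> conj_by y a = conj_by x a"
proof -
  obtain a b where ab: "a \<in> P" "b \<in> P" "x = a \<otimes> inv b"
    using fractions assms unfolding group_of_fractions_def by blast
  obtain k :: nat where k: "Z [^] k \<otimes> inv b \<in> P" using ex_Z_pow_inv_positive[OF ab(2)] by blast
  show ?thesis
  proof
    show "a \<otimes> (Z [^] k \<otimes> inv b) \<in> P" using ab k by simp
    fix g assume g: "g \<in> carrier G"
    have "a \<otimes> (Z [^] k \<otimes> inv b) = Z [^] k \<otimes> x"
      using ab Z_pow_central[of a k] by (simp add: m_assoc[symmetric])
    moreover have "conj_by (Z [^] k) g = g"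
      using g by (simp add: conj_by_eq_iff Z_pow_central)
    ultimately show "conj_by (a \<otimes> (Z [^] k \<otimes> inv b)) g = conj_by x g"
      using g assms by (simp add: conj_by_mult)
  qed
qed

section \<open>Chains of conjugations by simple elements\<close>

lemma conj_by_Z_pow:
  assumes "x \<in> carrier G" "a \<in> carrier G"
  shows "conj_by x (Z [^] (k::nat) \<otimes> a) = Z [^] k \<otimes> conj_by x a"
  using assms Z_pow_central[of "inv x" k] by (simp add: conj_by_def m_assoc[symmetric])

text \<open>Conjugation commutes with the shift by \<open>Z [^] k\<close>, so
  \<open>conj_head_positive\<close> applies to the shifts of both \<open>a\<close> and
  \<open>inv a\<close>.\<close>

lemma conj_head_interval:
  assumes "is_head d x" "x \<in> P" "a \<in> interval k" "conj_by x a \<in> interval k"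
  shows "conj_by d a \<in> interval k"
proof -
  have d: "d \<in> carrier G" using assms(1) by (simp add: is_head_def)
  have "Z [^] k \<otimes> conj_by d b \<in> P"
    if "b \<in> carrier G" "Z [^] k \<otimes> b \<in> P" "Z [^] k \<otimes> conj_by x b \<in> P" for b
    using conj_head_positive[OF assms(1) that(2) assms(2)] that d assms(2)
      conj_by_Z_pow[of x b k] conj_by_Z_pow[of d b k]
    by (simp add: conj_by_def)
  from this[of a] this[of "inv a"] show ?thesis
    using assms d by (simp add: interval_def inv_conj_by)
qed

text \<open>The edges of a graph on the tuples over the interval; requiring both ends to stay in the
  interval makes it finite.\<close>

definition simple_steps :: "nat \<Rightarrow> nat \<Rightarrow> ('a list \<times> 'a list) set" where
  "simple_steps k r = {(as, map (conj_by s) as) |as s. s \<in> S \<and> length as = r \<and>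
    set as \<subseteq> interval k \<and> set (map (conj_by s) as) \<subseteq> interval k}"

text \<open>Induction on the Noetherian bound of \<open>x\<close>: the head \<open>d\<close> is
  split off, and its conjugation stays in the interval. Prepending \<open>d\<close> to a
  factorisation of the quotient gives one of \<open>x\<close>, so the bound drops by one.\<close>

lemma simple_steps_chain:
  assumes "\<And>xs. set xs \<subseteq> P - {\<one>} \<Longrightarrow> list_prod G xs = x \<Longrightarrow> length xs \<le> n" and "x \<in> P"
    and "length as = r" and "set as \<subseteq> interval k" and "set (map (conj_by x) as) \<subseteq> interval k"
  shows "(as, map (conj_by x) as) \<in> (simple_steps k r)\<^sup>*"
  using assms
proof (induction n arbitrary: x as)
  case 0
  \<comment> \<open>The bound \<open>0\<close> excludes even the factorisation \<open>[x]\<close>,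
    unless \<open>x\<close> is trivial.\<close>
  have "x = \<one>" using "0.prems"(1)[of "[x]"] "0.prems"(2) by auto
  moreover have "map (conj_by \<one>) as = as"
    using "0.prems"(4) by (intro map_idI conj_by_one interval_closed[of _ k]) auto
  ultimately show ?case by simp
next
  case (Suc n)
  have carrier: "a \<in> carrier G" if "a \<in> set as" for a using Suc.prems(4) that interval_closed by blast
  obtain d where d: "is_head d x" using head_exists[OF Suc.prems(2)] .
  then have dS: "d \<in> S" "d \<preceq> x" by (auto simp: is_head_def)
  show ?case
  proof (cases "d = \<one>")
    case True
    then have "x = \<one>" using head_eq_one d Suc.prems(2) by simp
    moreover have "map (conj_by \<one>) as = as" using carrier by (intro map_idI) auto
    ultimately show ?thesis by simp
  next
    case False
    obtain y where y: "y \<in> P" "x = d \<otimes> y" using dS Suc.prems(2) by (auto simp: le_iff)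
    let ?bs = "map (conj_by d) as"
    have bs: "set ?bs \<subseteq> interval k"
      unfolding set_map
      by (intro image_subsetI conj_head_interval[OF d Suc.prems(2)]) (use Suc.prems(4,5) in auto)
    have conj: "map (conj_by y) ?bs = map (conj_by x) as"
      using carrier y dS by (simp add: conj_by_mult)
    have "(?bs, map (conj_by y) ?bs) \<in> (simple_steps k r)\<^sup>*"
    proof (rule Suc.IH)
      fix xs assume "set xs \<subseteq> P - {\<one>}" "list_prod G xs = y"
      then show "length xs \<le> n" using Suc.prems(1)[of "d # xs"] dS False y by simp
    qed (use y bs Suc.prems conj in simp_all)
    moreover have "(as, ?bs) \<in> simple_steps k r"
      unfolding simple_steps_def using dS bs Suc.prems(3,4) by blast
    ultimately show ?thesis unfolding conj by (rule converse_rtrancl_into_rtrancl[rotated])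
  qed
qed

lemma simple_steps_relpow:
  assumes "(as, cs) \<in> simple_steps k r ^^ m" and "set as \<subseteq> carrier G"
  shows "\<exists>ss. set ss \<subseteq> S \<and> length ss = m \<and> cs = map (conj_by (list_prod G ss)) as"
  using assms
proof (induction m arbitrary: as)
  case 0
  then have "map (conj_by \<one>) as = as" by (intro map_idI) auto
  with 0 show ?case by (intro exI[of _ "[]"]) simp
next
  case (Suc m)
  from Suc.prems(1) obtain bs where bs: "(as, bs) \<in> simple_steps k r" "(bs, cs) \<in> simple_steps k r ^^ m"
    by (meson relpow_Suc_D2)
  then obtain s where s: "s \<in> S" "bs = map (conj_by s) as" "set bs \<subseteq> interval k"
    unfolding simple_steps_def by blast
  then obtain ss where ss: "set ss \<subseteq> S" "length ss = m" "cs = map (conj_by (list_prod G ss)) bs"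
    using Suc.IH[OF bs(2)] interval_closed by blast
  have "list_prod G ss \<in> carrier G" using ss(1) simples_closed by auto
  then have "cs = map (conj_by (list_prod G (s # ss))) as"
    using ss s Suc.prems(2) by (auto simp: conj_by_mult)
  then show ?case using s ss by (intro exI[of _ "s # ss"]) simp
qed

text \<open>Path lengths will be bounded by the number of edges, which is at most the square of the
  number of vertices.\<close>

lemma card_simple_steps:
  "finite (simple_steps k r) \<and> card (simple_steps k r) \<le> ((card S ^ (e * (2 * k))) ^ r) ^ 2"
proof -
  let ?X = "{as. set as \<subseteq> interval k \<and> length as = r}"
  have fin: "finite ?X" using card_interval by (simp add: finite_lists_length_eq)
  have "card ?X \<le> (card S ^ (e * (2 * k))) ^ r"
    using card_interval[of k] by (simp add: card_lists_length_eq power_mono)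
  then have "card (?X \<times> ?X) \<le> ((card S ^ (e * (2 * k))) ^ r) ^ 2"
    by (simp add: card_cartesian_product power2_eq_square mult_mono)
  moreover have "simple_steps k r \<subseteq> ?X \<times> ?X" by (auto simp: simple_steps_def)
  ultimately show ?thesis
    using fin by (meson card_mono finite_SigmaI finite_subset order_trans)
qed

lemma simultaneously_conjugate_bounded:
  assumes "set as \<subseteq> interval k" "set cs \<subseteq> interval k" "length as = r"
  shows "simultaneously_conjugate G as cs \<longleftrightarrow>
    (\<exists>ss. set ss \<subseteq> S \<and> length ss = ((card S ^ (e * (2 * k))) ^ r) ^ 2 \<and>
      cs = map (conj_by (list_prod G ss)) as)" (is "_ \<longleftrightarrow> (\<exists>ss. _ \<and> length ss = ?N \<and> _)")
proof
  assume "simultaneously_conjugate G as cs"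
  then obtain x where "x \<in> carrier G" "cs = map (conj_by x) as"
    by (auto simp: simultaneously_conjugate_iff)
  then obtain y where y: "y \<in> P" "cs = map (conj_by y) as"
    using assms(1) positive_conjugator[of x]
    by (metis (no_types, lifting) interval_closed map_eq_conv subsetD)
  obtain n where "\<And>xs. set xs \<subseteq> P - {\<one>} \<Longrightarrow> list_prod G xs = y \<Longrightarrow> length xs \<le> n"
    using noetherian[OF y(1)] by blast
  from simple_steps_chain[OF this y(1) assms(3,1)] have "(as, cs) \<in> (simple_steps k r)\<^sup>*"
    using assms(2) y(2) by simp
  \<comment> \<open>In a finite relation, reachability is witnessed by a path with at most as many
    steps as the relation has pairs.\<close>
  then obtain m where m: "m \<le> card (simple_steps k r)" "(as, cs) \<in> simple_steps k r ^^ m"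
    using rtrancl_finite_eq_relpow[of "simple_steps k r"] card_simple_steps by auto
  obtain ss where ss: "set ss \<subseteq> S" "length ss = m" "cs = map (conj_by (list_prod G ss)) as"
    using simple_steps_relpow[OF m(2)] assms(1) interval_closed by blast
  have "m \<le> ?N" using m(1) card_simple_steps[of k r] by linarith
  \<comment> \<open>As \<open>\<one>\<close> is simple, the conjugating word can be padded to
    exactly the length \<open>?N\<close>.\<close>
  have "list_prod G (replicate i \<one>) = \<one>" for i by (induction i) simp_all
  moreover have "list_prod G ss \<in> carrier G" using ss(1) simples_closed by auto
  ultimately have "list_prod G (ss @ replicate (?N - m) \<one>) = list_prod G ss"
    using ss(1) simples_closed by (subst list_prod_append) auto
  then show "\<exists>ss. set ss \<subseteq> S \<and> length ss = ?N \<and> cs = map (conj_by (list_prod G ss)) as"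
    using ss \<open>m \<le> ?N\<close> by (intro exI[of _ "ss @ replicate (?N - m) \<one>"]) auto
next
  assume "\<exists>ss. set ss \<subseteq> S \<and> length ss = ?N \<and> cs = map (conj_by (list_prod G ss)) as"
  then show "simultaneously_conjugate G as cs"
    using simples_closed by (auto simp: simultaneously_conjugate_iff intro!: bexI list_prod_closed)
qed

end

section \<open>Word problem for positive words\<close>

context garside_group
begin

definition positive_lcm_of :: "'a \<Rightarrow> 'a \<Rightarrow> 'a" where
  "positive_lcm_of a b = (SOME m. m \<in> P \<and> a \<preceq> m \<and> b \<preceq> m \<and> (\<forall>m'\<in>P. a \<preceq> m' \<and> b \<preceq> m' \<longrightarrow> m \<preceq> m'))"

lemma positive_lcm_of:
  assumes "a \<in> P" "b \<in> P"
  shows "positive_lcm_of a b \<in> P" "a \<preceq> positive_lcm_of a b" "b \<preceq> positive_lcm_of a b"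
    "m \<in> P \<Longrightarrow> a \<preceq> m \<Longrightarrow> b \<preceq> m \<Longrightarrow> positive_lcm_of a b \<preceq> m"
proof -
  have "\<exists>m. m \<in> P \<and> a \<preceq> m \<and> b \<preceq> m \<and> (\<forall>m'\<in>P. a \<preceq> m' \<and> b \<preceq> m' \<longrightarrow> m \<preceq> m')"
    using positive_lcm[OF assms] by metis
  from someI_ex[OF this]
  show "positive_lcm_of a b \<in> P" "a \<preceq> positive_lcm_of a b" "b \<preceq> positive_lcm_of a b"
    "m \<in> P \<Longrightarrow> a \<preceq> m \<Longrightarrow> b \<preceq> m \<Longrightarrow> positive_lcm_of a b \<preceq> m"
    unfolding positive_lcm_of_def by blast+
qed

lemma positive_lcm_of_commute: "a \<in> P \<Longrightarrow> b \<in> P \<Longrightarrow> positive_lcm_of a b = positive_lcm_of b a"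
  by (intro prec_antisym positive_lcm_of positive_closed)

text \<open>The complement used in word reversing: the factor that extends \<open>t\<close> to the
  lcm of \<open>s\<close> and \<open>t\<close>.\<close>

definition residue :: "'a \<Rightarrow> 'a \<Rightarrow> 'a" where
  "residue s t = inv t \<otimes> positive_lcm_of s t"

lemma mult_residue: "s \<in> P \<Longrightarrow> t \<in> P \<Longrightarrow> t \<otimes> residue s t = positive_lcm_of s t"
  by (simp add: residue_def positive_lcm_of)

lemma residue_positive: "s \<in> P \<Longrightarrow> t \<in> P \<Longrightarrow> residue s t \<in> P"
  using positive_lcm_of(3) by (simp add: residue_def le_def)

lemma residue_swap: "s \<in> P \<Longrightarrow> t \<in> P \<Longrightarrow> s \<otimes> residue t s = t \<otimes> residue s t"
  by (simp add: mult_residue positive_lcm_of_commute)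

text \<open>The lcm divides \<Delta> and is therefore simple, and its right factors are right
  divisors of \<Delta>. So residues of simple elements form a finite table within
  \<open>S\<close>.\<close>

lemma residue_simple:
  assumes "s \<in> S" "t \<in> S" shows "residue s t \<in> S"
proof -
  let ?m = "positive_lcm_of s t"
  have m: "?m \<in> S"
    using assms positive_lcm_of[of s t] simple_iff_le by (metis Delta_in_positives simple_positive)
  have "\<Delta> \<otimes> inv (residue s t) = (\<Delta> \<otimes> inv ?m) \<otimes> t"
    using assms m by (simp add: residue_def inv_mult_group m_assoc)
  then have "\<Delta> \<otimes> inv (residue s t) \<in> P"
    using simple_left_complement[OF m] assms by simp
  then show ?thesis
    using residue_positive[of s t] assms simple_iff_right[of "residue s t"] by simp
qed

text \<open>Both sides say that the lcm of \<open>s\<close> and \<open>t\<close> divides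
  \<open>t \<otimes> v\<close>. A divisibility test is thereby moved past one letter.\<close>

lemma le_mult_iff_residue_le:
  assumes "s \<in> P" "t \<in> P" "v \<in> P"
  shows "s \<preceq> t \<otimes> v \<longleftrightarrow> residue s t \<preceq> v"
proof -
  have "s \<preceq> t \<otimes> v \<longleftrightarrow> positive_lcm_of s t \<preceq> t \<otimes> v"
    using assms positive_lcm_of[of s t] prec_trans[of s "positive_lcm_of s t" "t \<otimes> v"] by auto
  also have "\<dots> \<longleftrightarrow> t \<otimes> residue s t \<preceq> t \<otimes> v"
    using assms by (simp add: mult_residue)
  finally show ?thesis using assms residue_positive[of s t] by simp
qed

end

text \<open>
  If \<open>c (i, j)\<close> is the letter \<open>j\<inverse> lcm(i, j)\<close>, then \<open>divide c d ts\<close> consists of letters \<open>f\<close> and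
  \<open>q\<^sub>m, \<dots>, q\<^sub>1\<close> (in this order) such that \<open>d q\<^sub>1 \<dots> q\<^sub>m\<close> and \<open>ts f\<close> both represent the right lcm
  of \<open>d\<close> and \<open>ts\<close>.
\<close>

definition divide :: "(nat \<times> nat \<Rightarrow> nat) \<Rightarrow> nat \<Rightarrow> nat list \<Rightarrow> nat \<times> nat list" where
  "divide c d ts = fold (\<lambda>t p. (c (fst p, t), c (t, fst p) # snd p)) ts (d, [])"

text \<open>The letters of \<open>xs\<close> are divided off \<open>ys\<close> from the left one
  after another, while the flag records whether all divisions succeed. The remaining word must be
  trivial; \<open>u\<close> recognises the letters with value \<open>\<one>\<close>.\<close>

definition same_positive :: "(nat \<times> nat \<Rightarrow> nat) \<Rightarrow> (nat \<Rightarrow> bool) \<Rightarrow> nat list \<Rightarrow> nat list \<Rightarrow> bool" where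
  "same_positive c u xs ys \<longleftrightarrow>
    (let p = fold (\<lambda>d p. (fst p \<and> u (fst (divide c d (snd p))), rev (snd (divide c d (snd p))))) xs (True, ys)
     in fst p \<and> list_all u (snd p))"

section \<open>The decision procedure\<close>

text \<open>The equation \<open>a x = x b\<close> is multiplied by a power of \<open>Z\<close> with
  exponent \<open>length a + length b\<close>, which makes both sides positive: \<open>zs\<close> is
  to spell \<open>Z\<close>, and \<open>pos l\<close> to spell \<open>Z\<close> times the letter
  with code \<open>l\<close>.\<close>

definition conjugation_test ::
  "(nat \<times> nat \<Rightarrow> nat) \<Rightarrow> (nat \<Rightarrow> bool) \<Rightarrow> (nat \<Rightarrow> nat list) \<Rightarrow> nat list \<Rightarrow> nat list \<Rightarrow> nat list \<Rightarrow> nat list \<Rightarrow> bool" where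
  "conjugation_test c u pos zs x a b \<longleftrightarrow>
    same_positive c u
      (concat (replicate (length b) zs) @ concat (map pos a) @ x)
      (concat (replicate (length a) zs) @ x @ concat (map pos b))"

text \<open>List access in a form built from computable operations; the default \<open>[]\<close>
  makes it total.\<close>

definition entry :: "nat \<Rightarrow> 'x list list \<Rightarrow> 'x list" where
  "entry i us = (case drop i us of [] \<Rightarrow> [] | u # _ \<Rightarrow> u)"

lemma entry_eq_nth: "i < length us \<Longrightarrow> entry i us = us ! i"
  by (simp add: entry_def Cons_nth_drop_Suc[symmetric])

text \<open>Exhaustive search over the words of the length found in
  \<open>simultaneously_conjugate_bounded\<close>, with \<open>n\<close> simple elements and with
  the total number of input letters as \<open>k\<close>.\<close>

definition conjugacy_test ::
  "(nat list \<Rightarrow> nat list \<Rightarrow> nat list \<Rightarrow> bool) \<Rightarrow> nat \<Rightarrow> nat \<Rightarrow> nat \<Rightarrow> nat list list \<times> nat list list \<Rightarrow> bool" where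
  "conjugacy_test T n e r p \<longleftrightarrow>
    list_ex (\<lambda>x. list_all (\<lambda>i. T x (entry i (fst p)) (entry i (snd p))) [0..<r])
      (List.n_lists (((n ^ (e * (2 * (length (concat (fst p)) + length (concat (snd p)))))) ^ r) ^ 2) [0..<n])"

section \<open>Computability of the tests\<close>

lemma computable_tl [computable_intros]: "computable l \<Longrightarrow> computable (\<lambda>x. tl (l x))"
  unfolding tl_def by (intro computable_intros)

lemma computable_drop [computable_intros]:
  assumes "computable n" "computable l" shows "computable (\<lambda>x. drop (n x) (l x))"
proof -
  have "drop k ys = rec_nat ys (\<lambda>_. tl) k" for k and ys :: "'b list"
    by (induction k) (simp_all add: drop_Suc tl_drop[symmetric])
  then show ?thesis by (simp only:) (intro computable_intros assms)
qed

lemma computable_entry [computable_intros]: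
  "computable n \<Longrightarrow> computable l \<Longrightarrow> computable (\<lambda>x. entry (n x) (l x))"
  unfolding entry_def by (intro computable_intros)

lemma computable_n_lists [computable_intros]:
  assumes "computable n" "computable l" shows "computable (\<lambda>x. List.n_lists (n x) (l x))"
proof -
  have "List.n_lists k ys = rec_nat [[]] (\<lambda>_ zss. concat (map (\<lambda>zs. map (\<lambda>y. y # zs) ys) zss)) k"
    for k and ys :: "'b list"
    by (induction k) simp_all
  then show ?thesis
    by (simp only:) (intro computable_intros assms computable_comp[OF assms(2)])
qed

lemma computable_divide:
  assumes "computable c" "computable d" "computable ts"
  shows "computable (\<lambda>x. divide c (d x) (ts x))"
  unfolding divide_def by (intro computable_intros assms computable_comp[OF assms(1)])

lemma computable_same_positive:
  assumes "computable c" "computable u" "computable f" "computable g"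
  shows "computable (\<lambda>x. same_positive c u (f x) (g x))"
  unfolding same_positive_def Let_def
  by (intro computable_intros computable_divide computable_comp[OF assms(2)] assms)

lemma computable_conjugation_test:
  assumes "computable c" "computable u" "computable pos" "computable x" "computable a" "computable b"
  shows "computable (\<lambda>z. conjugation_test c u pos zs (x z) (a z) (b z))"
  unfolding conjugation_test_def
  by (intro computable_intros computable_same_positive computable_comp[OF assms(3)] assms)

lemma computable_conjugacy_test:
  assumes "computable (\<lambda>z. T (fst z) (fst (snd z)) (snd (snd z)))"
  shows "computable (conjugacy_test T n e r)"
proof -
  have T: "computable (\<lambda>z. T (f z) (g z) (h z))" if "computable f" "computable g" "computable h" for f g h
    using computable_comp[OF assms, of "\<lambda>z. (f z, g z, h z)"] that by (simp add: computable_intros)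
  show ?thesis
    unfolding conjugacy_test_def[abs_def] by (intro computable_intros T)
qed

section \<open>Correctness of the tests for numbered simple elements\<close>

locale numbered_garside_group = central_garside_group +
  fixes num :: "'a \<Rightarrow> nat"
  assumes num: "bij_betw num S {..<card S}"
begin

definition simple_of :: "nat \<Rightarrow> 'a" where
  "simple_of i = inv_into S num i"

definition val :: "nat list \<Rightarrow> 'a" where
  "val xs = list_prod G (map simple_of xs)"

lemma num_less [simp]: "s \<in> S \<Longrightarrow> num s < card S"
  using num by (auto simp: bij_betw_def)

lemma simple_of_simple [simp]: "i < card S \<Longrightarrow> simple_of i \<in> S"
  unfolding simple_of_def using num by (intro inv_into_into) (auto simp: bij_betw_def)

lemma simple_of_num [simp]: "s \<in> S \<Longrightarrow> simple_of (num s) = s"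
  unfolding simple_of_def using num by (simp add: bij_betw_def)

lemma val_Nil [simp]: "val [] = \<one>"
  and val_Cons [simp]: "val (x # xs) = simple_of x \<otimes> val xs"
  by (simp_all add: val_def)

lemma val_positive [simp]: "set xs \<subseteq> {..<card S} \<Longrightarrow> val xs \<in> P"
  by (induction xs) simp_all

lemma val_append:
  "set xs \<subseteq> {..<card S} \<Longrightarrow> set ys \<subseteq> {..<card S} \<Longrightarrow> val (xs @ ys) = val xs \<otimes> val ys"
  by (induction xs) (simp_all add: m_assoc)

lemma ex_val_eq: "x \<in> P \<Longrightarrow> \<exists>xs. set xs \<subseteq> {..<card S} \<and> val xs = x"
proof (induction rule: monoid_generate.induct)
  case one
  show ?case by (intro exI[of _ "[]"]) simp
next
  case (incl s)
  then show ?case by (intro exI[of _ "[num s]"]) simp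
next
  case (mult x y)
  then obtain xs ys where "set xs \<subseteq> {..<card S}" "val xs = x" "set ys \<subseteq> {..<card S}" "val ys = y"
    by blast
  then show ?case by (intro exI[of _ "xs @ ys"]) (simp add: val_append)
qed

text \<open>In the absence of nontrivial units a product is trivial only if all factors are.\<close>

lemma val_eq_one_iff:
  "set xs \<subseteq> {..<card S} \<Longrightarrow> val xs = \<one> \<longleftrightarrow> (\<forall>x\<in>set xs. simple_of x = \<one>)"
  by (induction xs) (simp_all add: positive_mult_eq_one_iff)

context
  fixes c :: "nat \<times> nat \<Rightarrow> nat" and u :: "nat \<Rightarrow> bool"
  assumes c: "\<And>i j. i < card S \<Longrightarrow> j < card S \<Longrightarrow> c (i, j) = num (residue (simple_of i) (simple_of j))"
    and u: "\<And>i. i < card S \<Longrightarrow> u i \<longleftrightarrow> simple_of i = \<one>"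
begin

lemma c_simple:
  assumes "i < card S" "j < card S"
  shows "c (i, j) < card S" "simple_of (c (i, j)) = residue (simple_of i) (simple_of j)"
  using assms residue_simple by (simp_all add: c)

text \<open>Each letter \<open>t\<close> of the word contributes one lcm square, by
  \<open>residue_swap\<close>. The test whether \<open>d\<close> divides the word becomes the test
  whether its residue divides the rest; at the empty word only \<open>\<one>\<close> passes.\<close>

lemma divide_correct_aux:
  assumes "d < card S" "set ts \<subseteq> {..<card S}"
  shows "\<exists>f qs. fold (\<lambda>t p. (c (fst p, t), c (t, fst p) # snd p)) ts (d, acc) = (f, rev qs @ acc) \<and>
    f < card S \<and> set qs \<subseteq> {..<card S} \<and> simple_of d \<otimes> val qs = val ts \<otimes> simple_of f \<and>
    (simple_of d \<preceq> val ts \<longleftrightarrow> simple_of f = \<one>)"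
  using assms
proof (induction ts arbitrary: d acc)
  case Nil
  then show ?case by (simp add: le_one_iff)
next
  case (Cons t ts)
  let ?d = "simple_of d" and ?t = "simple_of t"
  have dt: "d < card S" "t < card S" "set ts \<subseteq> {..<card S}" using Cons.prems by auto
  then have S: "?d \<in> S" "?t \<in> S" by simp_all
  obtain f qs where f: "fold (\<lambda>t p. (c (fst p, t), c (t, fst p) # snd p)) ts (c (d, t), c (t, d) # acc)
      = (f, rev qs @ (c (t, d) # acc))" "f < card S" "set qs \<subseteq> {..<card S}"
    "residue ?d ?t \<otimes> val qs = val ts \<otimes> simple_of f"
    "residue ?d ?t \<preceq> val ts \<longleftrightarrow> simple_of f = \<one>"
    using Cons.IH[of "c (d, t)" "c (t, d) # acc"] c_simple[OF dt(1,2)] dt(3) by auto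
  have "?d \<otimes> (residue ?t ?d \<otimes> val qs) = (?t \<otimes> residue ?d ?t) \<otimes> val qs"
    using S f(3) residue_positive[of ?t ?d] residue_swap[of ?d ?t] by (simp add: m_assoc[symmetric])
  also have "\<dots> = ?t \<otimes> val ts \<otimes> simple_of f"
    using S f(2,3,4) dt(3) residue_positive[of ?d ?t] by (simp add: m_assoc)
  finally have "?d \<otimes> val (c (t, d) # qs) = val (t # ts) \<otimes> simple_of f"
    using c_simple[OF dt(2,1)] by simp
  moreover have "?d \<preceq> val (t # ts) \<longleftrightarrow> simple_of f = \<one>"
    using f(5) le_mult_iff_residue_le[of ?d ?t "val ts"] S dt(3) by simp
  ultimately show ?case
    using f(1-3) c_simple[OF dt(2,1)] by (intro exI[of _ f] exI[of _ "c (t, d) # qs"]) simp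
qed

lemma divide_correct:
  assumes "d < card S" "set ts \<subseteq> {..<card S}"
  obtains f qs where "divide c d ts = (f, rev qs)" "f < card S" "set qs \<subseteq> {..<card S}"
    "simple_of d \<otimes> val qs = val ts \<otimes> simple_of f"
    "simple_of d \<preceq> val ts \<longleftrightarrow> simple_of f = \<one>"
  using divide_correct_aux[OF assms, of "[]"] unfolding divide_def by auto

text \<open>If \<open>d\<close> divides the value of \<open>ys\<close>, then \<open>qs\<close>
  spells the quotient and \<open>d\<close> cancels. If not, the values differ, because
  \<open>d\<close> divides that of \<open>d # xs\<close>.\<close>

lemma same_positive_correct:
  assumes "set xs \<subseteq> {..<card S}" "set ys \<subseteq> {..<card S}"
  shows "same_positive c u xs ys \<longleftrightarrow> val xs = val ys"
proof -
  define g where "g = (\<lambda>d p. (fst p \<and> u (fst (divide c d (snd p))), rev (snd (divide c d (snd p)))))"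
  have "fst (fold g xs (b, ys)) \<and> list_all u (snd (fold g xs (b, ys))) \<longleftrightarrow> b \<and> val xs = val ys" for b
    using assms
  proof (induction xs arbitrary: b ys)
    case Nil
    then have "list_all u ys \<longleftrightarrow> val ys = \<one>"
      using u by (auto simp: val_eq_one_iff list_all_iff)
    then show ?case by auto
  next
    case (Cons d xs)
    then have d: "d < card S" "set xs \<subseteq> {..<card S}" by simp_all
    obtain f qs where f: "divide c d ys = (f, rev qs)" "f < card S" "set qs \<subseteq> {..<card S}"
      "simple_of d \<otimes> val qs = val ys \<otimes> simple_of f"
      "simple_of d \<preceq> val ys \<longleftrightarrow> simple_of f = \<one>"
      using divide_correct[OF d(1) Cons.prems(2)] .
    have "g d (b, ys) = (b \<and> simple_of f = \<one>, qs)"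
      using f u by (simp add: g_def)
    then have "fst (fold g (d # xs) (b, ys)) \<and> list_all u (snd (fold g (d # xs) (b, ys))) \<longleftrightarrow>
      (b \<and> simple_of f = \<one>) \<and> val xs = val qs"
      using Cons.IH[OF d(2) f(3), of "b \<and> simple_of f = \<one>"] by simp
    also have "\<dots> \<longleftrightarrow> b \<and> val (d # xs) = val ys"
    proof (cases "simple_of f = \<one>")
      case True
      then have "val ys = simple_of d \<otimes> val qs" using f(4) Cons.prems(2) by simp
      then show ?thesis using True d f(3) by simp
    next
      case False
      moreover have "simple_of d \<preceq> val (d # xs)" using d by simp
      ultimately have "val (d # xs) \<noteq> val ys" using f(5) by metis
      then show ?thesis using False by simp
    qed
    finally show ?case .
  qed
  from this[of True] show ?thesis
    unfolding same_positive_def g_def by (simp add: Let_def)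
qed

context
  fixes pos :: "nat \<Rightarrow> nat list" and zs :: "nat list"
  assumes pos: "\<And>l. l \<in> S \<times> UNIV \<Longrightarrow> set (pos (letter_code num l)) \<subseteq> {..<card S} \<and>
      val (pos (letter_code num l)) = Z \<otimes> letter_value G l"
    and zs: "set zs \<subseteq> {..<card S}" "val zs = Z"
begin

lemma val_replicate:
  "set (concat (replicate k zs)) \<subseteq> {..<card S} \<and> val (concat (replicate k zs)) = Z [^] k"
proof (induction k)
  case (Suc k)
  then show ?case using zs Z_pow_central[of Z k] by (auto simp: val_append)
qed simp

text \<open>Every letter brings along one factor \<open>Z\<close>, which is central and can be
  collected in front.\<close>

lemma val_pos_word:
  assumes "w \<in> words S"
  shows "set (concat (map pos (map (letter_code num) w))) \<subseteq> {..<card S} \<and>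
    val (concat (map pos (map (letter_code num) w))) = Z [^] length w \<otimes> word_value G w"
  using assms
proof (induction w)
  case Nil
  then show ?case by (simp add: word_value_def)
next
  case (Cons l w)
  then have l: "l \<in> S \<times> UNIV" and w: "w \<in> words S" by (simp_all add: words_def)
  have closed: "letter_value G l \<in> carrier G" "word_value G w \<in> carrier G"
    using letter_in_interval[OF l] word_in_interval[OF w] interval_closed by blast+
  have "(Z \<otimes> letter_value G l) \<otimes> (Z [^] length w \<otimes> word_value G w) =
    Z \<otimes> (letter_value G l \<otimes> Z [^] length w) \<otimes> word_value G w"
    using closed by (simp add: m_assoc)
  also have "\<dots> = Z \<otimes> (Z [^] length w \<otimes> letter_value G l) \<otimes> word_value G w"
    by (simp only: Z_pow_central[OF closed(1)])
  also have "\<dots> = (Z \<otimes> Z [^] length w) \<otimes> (letter_value G l \<otimes> word_value G w)"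
    using closed by (simp add: m_assoc)
  also have "Z \<otimes> Z [^] length w = Z [^] Suc (length w)"
    by (simp add: Z_pow_central)
  finally show ?case
    using Cons.IH[OF w] pos[OF l] by (simp add: val_append word_value_def)
qed

lemma conjugation_test_correct:
  assumes "a \<in> words S" "b \<in> words S" "set x \<subseteq> {..<card S}"
  shows "conjugation_test c u pos zs x (map (letter_code num) a) (map (letter_code num) b) \<longleftrightarrow>
    conj_by (val x) (word_value G a) = word_value G b"
proof -
  let ?a = "word_value G a" and ?b = "word_value G b" and ?x = "val x"
  have closed: "?a \<in> carrier G" "?b \<in> carrier G" "?x \<in> carrier G"
    using word_in_interval assms interval_closed by (blast, blast, simp)
  have "conjugation_test c u pos zs x (map (letter_code num) a) (map (letter_code num) b) \<longleftrightarrow>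
    Z [^] length b \<otimes> (Z [^] length a \<otimes> ?a \<otimes> ?x) = Z [^] length a \<otimes> (?x \<otimes> (Z [^] length b \<otimes> ?b))"
    unfolding conjugation_test_def
    using assms(3) val_replicate val_pos_word[OF assms(1)] val_pos_word[OF assms(2)]
    by (subst same_positive_correct) (simp_all add: val_append)
  also have "Z [^] length b \<otimes> (Z [^] length a \<otimes> ?a \<otimes> ?x) =
    Z [^] length a \<otimes> (Z [^] length b \<otimes> (?a \<otimes> ?x))"
    using closed Z_pow_central[of "Z [^] length b" "length a"] by (simp add: m_assoc[symmetric])
  also have "?x \<otimes> (Z [^] length b \<otimes> ?b) = Z [^] length b \<otimes> (?x \<otimes> ?b)"
    using closed Z_pow_central[of ?x "length b"] by (simp add: m_assoc[symmetric])
  finally show ?thesis using closed by (simp add: conj_by_eq_iff)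
qed

lemma conjugacy_test_correct:
  assumes "us \<in> word_tuples S r" "vs \<in> word_tuples S r"
  shows "conjugacy_test (conjugation_test c u pos zs) (card S) e r
      (map (map (letter_code num)) us, map (map (letter_code num)) vs) \<longleftrightarrow>
    simultaneously_conjugate G (map (word_value G) us) (map (word_value G) vs)"
proof -
  let ?L = "map (map (letter_code num))"
  \<comment> \<open>The total number of letters dominates the length of each single word, so one
    interval contains all entries of both tuples.\<close>
  let ?k = "length (concat us) + length (concat vs)"
  let ?N = "((card S ^ (e * (2 * ?k))) ^ r) ^ 2"
  have len: "length us = r" "length vs = r" using assms by (simp_all add: word_tuples_def)
  have words: "us ! i \<in> words S" "vs ! i \<in> words S" if "i < r" for i
    using assms that nth_mem by (force simp: word_tuples_def)+
  have interval: "word_value G w \<in> interval ?k" if "w \<in> words S" "length w \<le> ?k" for w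
    using word_in_interval[OF that(1)] interval_mono[OF that(2)] by blast
  have length_le: "length w \<le> length (concat ws)" if "w \<in> set ws" for w and ws :: "'a word list"
    using that by (induction ws) auto
  have "word_value G w \<in> interval ?k" if "w \<in> set us \<union> set vs" for w
    using that assms length_le[of w us] length_le[of w vs] by (intro interval) (auto simp: word_tuples_def)
  then have bounds: "set (map (word_value G) us) \<subseteq> interval ?k" "set (map (word_value G) vs) \<subseteq> interval ?k"
    by auto
  have lists: "(\<exists>ss. set ss \<subseteq> S \<and> length ss = m \<and> Q (list_prod G ss)) \<longleftrightarrow>
    (\<exists>x. set x \<subseteq> {..<card S} \<and> length x = m \<and> Q (val x))" for m Q
  proof
    assume "\<exists>ss. set ss \<subseteq> S \<and> length ss = m \<and> Q (list_prod G ss)"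
    then obtain ss where ss: "set ss \<subseteq> S" "length ss = m" "Q (list_prod G ss)" by blast
    then have "map (simple_of \<circ> num) ss = ss" by (intro map_idI) auto
    with ss show "\<exists>x. set x \<subseteq> {..<card S} \<and> length x = m \<and> Q (val x)"
      by (intro exI[of _ "map num ss"]) (auto simp: val_def)
  next
    assume "\<exists>x. set x \<subseteq> {..<card S} \<and> length x = m \<and> Q (val x)"
    then obtain x where "set x \<subseteq> {..<card S}" "length x = m" "Q (val x)" by blast
    then show "\<exists>ss. set ss \<subseteq> S \<and> length ss = m \<and> Q (list_prod G ss)"
      by (intro exI[of _ "map simple_of x"]) (auto simp: val_def)
  qed
  have "length (concat (?L ws)) = length (concat ws)" for ws
    by (simp add: length_concat o_def)
  then have "conjugacy_test (conjugation_test c u pos zs) (card S) e r (?L us, ?L vs) \<longleftrightarrow>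
    (\<exists>x. set x \<subseteq> {..<card S} \<and> length x = ?N \<and>
      (\<forall>i<r. conjugation_test c u pos zs x (map (letter_code num) (us ! i)) (map (letter_code num) (vs ! i))))"
    unfolding conjugacy_test_def list_ex_iff set_n_lists list_all_iff
    using len by (auto simp: entry_eq_nth lessThan_atLeast0)
  also have "\<dots> \<longleftrightarrow> (\<exists>x. set x \<subseteq> {..<card S} \<and> length x = ?N \<and>
      map (word_value G) vs = map (conj_by (val x)) (map (word_value G) us))"
  proof (intro arg_cong[where f = Ex] ext conj_cong refl)
    fix x assume x: "set x \<subseteq> {..<card S}"
    have "map (word_value G) vs = map (conj_by (val x)) (map (word_value G) us) \<longleftrightarrow>
      (\<forall>i<r. conj_by (val x) (word_value G (us ! i)) = word_value G (vs ! i))"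
      using len by (auto simp: list_eq_iff_nth_eq)
    then show "(\<forall>i<r. conjugation_test c u pos zs x (map (letter_code num) (us ! i))
        (map (letter_code num) (vs ! i))) \<longleftrightarrow>
      map (word_value G) vs = map (conj_by (val x)) (map (word_value G) us)"
      using conjugation_test_correct[OF words x] by simp
  qed
  also have "\<dots> \<longleftrightarrow> simultaneously_conjugate G (map (word_value G) us) (map (word_value G) vs)"
    using simultaneously_conjugate_bounded[OF bounds, of r] len
      lists[of ?N "\<lambda>x. map (word_value G) vs = map (conj_by x) (map (word_value G) us)"] by simp
  finally show ?thesis .
qed

end

end

text \<open>What depends on the group is finite and goes into the program: the residue table, the
  test for \<open>\<one>\<close>, a positive word for \<open>Z\<close> and one for each letter
  shifted by \<open>Z\<close>.\<close>

lemma simultaneous_conjugacy_decidable: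
  "decidable_on (instance_code num) (word_tuples S r \<times> word_tuples S r)
    (\<lambda>(u, v). simultaneously_conjugate G (map (word_value G) u) (map (word_value G) v))"
proof -
  obtain c :: "nat \<times> nat \<Rightarrow> nat" where c: "computable c"
    "\<And>p. p \<in> {..<card S} \<times> {..<card S} \<Longrightarrow> c p = num (residue (simple_of (fst p)) (simple_of (snd p)))"
    using computable_on_finite[of "{..<card S} \<times> {..<card S}"
        "\<lambda>p. num (residue (simple_of (fst p)) (simple_of (snd p)))"] by auto
  obtain u where u: "computable u" "\<And>i. i \<in> {..<card S} \<Longrightarrow> u i \<longleftrightarrow> simple_of i = \<one>"
    using computable_on_finite[of "{..<card S}" "\<lambda>i. simple_of i = \<one>"] by auto
  \<comment> \<open>The table \<open>pos\<close> is indexed by letter codes, so a letter must be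
    recoverable from its code: parity gives the sign, the half gives the generator.\<close>
  have inj: "inj_on (letter_code num) (S \<times> UNIV)"
  proof (rule inj_onI)
    fix l l' assume l: "l \<in> S \<times> (UNIV :: bool set)" "l' \<in> S \<times> (UNIV :: bool set)"
      and eq: "letter_code num l = letter_code num l'"
    from eq have "num (fst l) = num (fst l')" "snd l = snd l'"
      by (auto simp: letter_code_def of_bool_def split: if_splits) presburger+
    moreover from this(1) have "fst l = fst l'"
      using l inj_onD[OF bij_betw_imp_inj_on[OF num]] by (auto simp: mem_Times_iff)
    ultimately show "l = l'" by (simp add: prod_eq_iff)
  qed
  have "Z \<otimes> letter_value G l \<in> P" if "l \<in> S \<times> UNIV" for l
    using letter_in_interval[OF that] by (simp add: interval_def)
  then have "\<forall>l\<in>S \<times> UNIV. \<exists>xs. set xs \<subseteq> {..<card S} \<and> val xs = Z \<otimes> letter_value G l"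
    using ex_val_eq by blast
  then obtain h where h: "\<And>l. l \<in> S \<times> UNIV \<Longrightarrow> set (h l) \<subseteq> {..<card S} \<and> val (h l) = Z \<otimes> letter_value G l"
    by metis
  obtain pos where pos: "computable pos" "\<And>i. i \<in> letter_code num ` (S \<times> UNIV) \<Longrightarrow>
      pos i = h (inv_into (S \<times> UNIV) (letter_code num) i)"
    using computable_on_finite[of "letter_code num ` (S \<times> UNIV)"
        "\<lambda>i. h (inv_into (S \<times> UNIV) (letter_code num) i)"] simples_finite by auto
  obtain zs where zs: "set zs \<subseteq> {..<card S}" "val zs = Z"
    using ex_val_eq[of Z] by auto
  let ?T = "conjugacy_test (conjugation_test c u pos zs) (card S) e r"
  let ?L = "\<lambda>p. (map (map (letter_code num)) (fst p), map (map (letter_code num)) (snd p))"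
  show ?thesis
  proof (rule decidable_on_computable)
    show "computable ?T"
      by (intro computable_conjugacy_test computable_conjugation_test c u pos computable_intros)
    show "encode (?L p) = instance_code num p" for p
      by (simp add: instance_code_def tuple_code_def word_code_def[abs_def] encode_list_def
          encode_nat_def[abs_def] o_def)
    show "?T (?L p) = (\<lambda>(u, v). simultaneously_conjugate G (map (word_value G) u) (map (word_value G) v)) p"
      if "p \<in> word_tuples S r \<times> word_tuples S r" for p
      using conjugacy_test_correct[of c u pos zs "fst p" r "snd p"] that c u pos h zs inj
      by (auto simp: case_prod_beta)
  qed
qed

end

theorem theorem4p5:
  fixes G :: "('a, 'b) monoid_scheme" and S :: "'a set" and \<Delta> :: 'a
    and num :: "'a \<Rightarrow> nat" and r :: nat
  assumes "garside_group G S \<Delta>"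
    and "bij_betw num S {..<card S}"
  shows "decidable_on (instance_code num) (word_tuples S r \<times> word_tuples S r)
    (\<lambda>(u, v). simultaneously_conjugate G (map (word_value G) u) (map (word_value G) v))"
proof -
  interpret garside_group G S \<Delta> by (rule assms(1))
  obtain e :: nat where "e > 0"
    "\<And>g. g \<in> carrier G \<Longrightarrow> \<Delta> [^]\<^bsub>G\<^esub> e \<otimes>\<^bsub>G\<^esub> g = g \<otimes>\<^bsub>G\<^esub> \<Delta> [^]\<^bsub>G\<^esub> e"
    using Delta_power_central by blast
  then interpret numbered_garside_group G S \<Delta> e num
    by unfold_locales (simp_all add: assms(2))
  show ?thesis by (rule simultaneous_conjugacy_decidable)
qed

end
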